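(* Let $p>1$, $p'=\frac{p}{p-1}$, and $\alpha>-1$. A measurable function $h:(0,\infty)\to\mathbb{R}$ belongs to $\mathrm{Cop}_{p,\alpha}$ if and only if it admits a factorization $h=f\cdot g$ with $f\in L^p_\alpha$ and $g\in G^*_{p',\alpha(1-p')}$. Moreover, for every such $h$, $$\frac{(p-1)^{1/p'}}{\alpha+1}\,N^*(h)\le\|h\|_{\mathrm{Cop}_{p,\alpha}}\le\frac{p}{\alpha+1}\,N^*(h),$$ where $$N^*(h)=\inf\|f\|_{L^p_\alpha}\|g\|_{G^*_{p',\alpha(1-p')}},$$ the infimum being taken over all factorizations $h=f\cdot g$ with $f\in L^p_\alpha$ and $g\in G^*_{p',\alpha(1-p')}$. The constants in both inequalities are optimal, i.e. $\frac{(p-1)^{1/p'}}{\alpha+1}$ cannot be replaced by a larger constant and $\frac{p}{\alpha+1}$ cannot be replaced by a smaller constant, if the inequalities are to hold for all $h\in\mathrm{Cop}_{p,\alpha}$.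
   Context: All functions are real-valued and Lebesgue measurable on $(0,\infty)$; equalities between functions are a.e. The spaces are those for power weights: $L^p_\alpha$ is the set of $f$ with $\|f\|_{L^p_\alpha}=\left(\int_0^\infty|f(x)|^p x^\alpha\,dx\right)^{1/p}<\infty$. $\mathrm{Cop}_{p,\alpha}$ is the set of $f$ with $\|f\|_{\mathrm{Cop}_{p,\alpha}}=\left(\int_0^\infty\left(\int_t^\infty\frac{|f(x)|}{x}\,dx\right)^p t^\alpha\,dt\right)^{1/p}<\infty$. For $q>0$ and $\beta$ real with $\beta-q<-1$, $G^*_{q,\beta}$ is the set of $g$ with $$\|g\|_{G^*_{q,\beta}}=\sup_{t>0}\left(\frac{1}{\int_t^\infty x^{\beta-q}\,dx}\int_t^\infty|g(x)|^q x^{\beta-q}\,dx\right)^{1/q}<\infty.$$ *)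

theory Defs
  imports "HOL-Analysis.Analysis"
begin

text \<open>
  The norms are taken in \<^typ>\<open>ennreal\<close>, so that they are meaningful for every measurable function
  and membership in a space is finiteness of the norm. Functions on the half-line are functions
  on \<^typ>\<open>real\<close> of which only the values on \<open>{0<..}\<close> matter.
\<close>

text \<open>The power \<open>x \<mapsto> x\<^sup>r\<close> on the extended half-line, for \<open>r > 0\<close>; in particular \<open>0\<^sup>r = 0\<close>.\<close>

definition epowr :: "ennreal \<Rightarrow> real \<Rightarrow> ennreal" where
  "epowr x r = (if x = \<infinity> then \<infinity> else ennreal (enn2real x powr r))"

abbreviation halfline :: "real measure" where
  "halfline \<equiv> lebesgue_on {0<..}"

definition Lp_norm :: "real \<Rightarrow> real \<Rightarrow> (real \<Rightarrow> real) \<Rightarrow> ennreal" where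
  "Lp_norm p \<alpha> f =
     epowr (\<integral>\<^sup>+x\<in>{0<..}. ennreal (\<bar>f x\<bar> powr p * x powr \<alpha>) \<partial>lebesgue) (1 / p)"

definition Lp :: "real \<Rightarrow> real \<Rightarrow> (real \<Rightarrow> real) set" where
  "Lp p \<alpha> = {f \<in> borel_measurable halfline. Lp_norm p \<alpha> f < \<infinity>}"

definition Cop_norm :: "real \<Rightarrow> real \<Rightarrow> (real \<Rightarrow> real) \<Rightarrow> ennreal" where
  "Cop_norm p \<alpha> f =
     epowr (\<integral>\<^sup>+t\<in>{0<..}.
        epowr (\<integral>\<^sup>+x\<in>{t<..}. ennreal (\<bar>f x\<bar> / x) \<partial>lebesgue) p * ennreal (t powr \<alpha>)
      \<partial>lebesgue) (1 / p)"

definition Cop :: "real \<Rightarrow> real \<Rightarrow> (real \<Rightarrow> real) set" where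
  "Cop p \<alpha> = {f \<in> borel_measurable halfline. Cop_norm p \<alpha> f < \<infinity>}"

text \<open>
  Intended for \<open>q > 0\<close> and \<open>\<beta> - q < - 1\<close>, in which case the normalising integral is
  positive and finite for every \<open>t > 0\<close>.
\<close>

definition Gstar_norm :: "real \<Rightarrow> real \<Rightarrow> (real \<Rightarrow> real) \<Rightarrow> ennreal" where
  "Gstar_norm q \<beta> g =
     (SUP t\<in>{0<..}.
        epowr (1 / (\<integral>\<^sup>+x\<in>{t<..}. ennreal (x powr (\<beta> - q)) \<partial>lebesgue) *
               (\<integral>\<^sup>+x\<in>{t<..}. ennreal (\<bar>g x\<bar> powr q * x powr (\<beta> - q)) \<partial>lebesgue)) (1 / q))"

definition Gstar :: "real \<Rightarrow> real \<Rightarrow> (real \<Rightarrow> real) set" where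
  "Gstar q \<beta> = {g \<in> borel_measurable halfline. Gstar_norm q \<beta> g < \<infinity>}"

definition is_factorization ::
    "real \<Rightarrow> real \<Rightarrow> real \<Rightarrow> (real \<Rightarrow> real) \<Rightarrow> (real \<Rightarrow> real) \<Rightarrow> (real \<Rightarrow> real) \<Rightarrow> bool" where
  "is_factorization p p' \<alpha> h f g \<longleftrightarrow>
     f \<in> Lp p \<alpha> \<and> g \<in> Gstar p' (\<alpha> * (1 - p')) \<and> (AE x in halfline. h x = f x * g x)"

definition Nstar :: "real \<Rightarrow> real \<Rightarrow> real \<Rightarrow> (real \<Rightarrow> real) \<Rightarrow> ennreal" where
  "Nstar p p' \<alpha> h =
     (INF (f, g)\<in>{(f, g). is_factorization p p' \<alpha> h f g}.
        Lp_norm p \<alpha> f * Gstar_norm p' (\<alpha> * (1 - p')) g)"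

end

theory Submission
  imports Defs
begin

text \<open>
  Write \<open>q = p'\<close>, \<open>H t\<close> for the integral of \<open>\<bar>h\<bar> / x\<close> over \<open>(t, \<infinity>)\<close>, \<open>\<delta> = (\<alpha> + 1) / p\<close> and
  \<open>\<gamma> = (\<alpha> + 1) / (p - 1)\<close>. The norm of \<open>g\<close> in \<open>G\<^sup>*\<close> compares the tails of \<open>\<bar>g\<bar> powr q\<close> with respect to
  the weight \<open>x powr (- \<gamma> - 1)\<close> with those of a constant function.

  The upper inequality is Hardy's inequality for \<open>H\<close> with a weight \<open>g\<close>. Schur's proof splits
  \<open>\<bar>f g\<bar> / x\<close> by Hoelder's inequality with an auxiliary power of \<open>x\<close>, and it needs of \<open>g\<close> only that
  \<open>\<bar>g\<bar> powr q\<close> times that power has tails no larger, up to a factor, than a constant would have.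
  Comparison of tails is preserved under multiplication by increasing powers (\<open>set_nn_integral_tail_powr_le\<close>), so
  the constant is that of the classical case \<open>g = 1\<close> (\<open>Cop_norm_mult_le\<close>).

  For the lower inequality the factorization is explicit. Put
  \<open>\<sigma> x = \<integral> H powr (p - 1) * \<tau> powr \<alpha> d\<tau>\<close> over \<open>(0, x)\<close> and distribute powers of \<open>\<bar>h\<bar>\<close>, \<open>\<sigma>\<close> and \<open>x\<close>
  such that \<open>\<bar>f\<bar> powr p * x powr \<alpha> = \<sigma> \<bar>h\<bar> / x\<close> and
  \<open>\<bar>g\<bar> powr q * x powr (- \<gamma> - 1) = \<sigma> powr (- 1 / (p - 1)) \<bar>h\<bar> / x\<close>. By Tonelli's theorem the norm of
  \<open>f\<close> is exactly the Copson norm of \<open>h\<close> (\<open>Lp_norm_left_factor\<close>). As \<open>H\<close> decreases,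
  \<open>\<sigma> t \<ge> H t powr (p - 1) * t powr (\<alpha> + 1) / (\<alpha> + 1)\<close>, and as \<open>\<sigma>\<close> increases, the tail of
  \<open>\<bar>g\<bar> powr q\<close> at \<open>t\<close> is at most \<open>\<sigma> t powr (- 1 / (p - 1)) * H t\<close>. Together these bound the norm of
  \<open>g\<close> by a constant independent of \<open>h\<close> (\<open>Gstar_norm_right_factor_le\<close>), and this constant is the
  reciprocal of the one in the theorem.

  The lower constant is optimal because of functions concentrated near one point: there \<open>H\<close> is
  nearly a multiple of the indicator of \<open>(0, 1)\<close>, and Hoelder's inequality on \<open>(1, \<infinity>)\<close> bounds every
  factorization norm from below by a multiple of \<open>H 1\<close> (\<open>copson_one_le_Nstar\<close>). The upper constant is
  optimal because of the powers \<open>x powr - a\<close> on \<open>(1, \<infinity>)\<close>, with \<open>a\<close> decreasing to \<open>\<delta>\<close> and \<open>g = 1\<close>.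
\<close>

section \<open>Real powers of extended nonnegative numbers\<close>

lemma epowr_ennreal: "0 \<le> a \<Longrightarrow> epowr (ennreal a) r = ennreal (a powr r)"
  by (simp add: epowr_def)

lemma epowr_top [simp]: "epowr top r = top"
  by (simp add: epowr_def)

lemma epowr_0 [simp]: "epowr 0 r = 0"
  by (simp add: epowr_def)

lemma epowr_one_right [simp]: "epowr x 1 = x"
  by (cases x) (auto simp: epowr_ennreal)

lemma epowr_lt_top_iff [simp]: "epowr x r < top \<longleftrightarrow> x < top"
  by (cases x) (auto simp: epowr_ennreal)

lemma epowr_eq_0_iff [simp]: "epowr x r = 0 \<longleftrightarrow> x = 0"
  by (cases x) (auto simp: epowr_ennreal ennreal_eq_0_iff)

lemma epowr_mono:
  assumes "x \<le> y" "0 \<le> r"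
  shows "epowr x r \<le> epowr y r"
  using assms
  by (cases x; cases y) (auto simp: epowr_ennreal top_unique intro!: ennreal_leI powr_mono2)

lemma epowr_mult: "epowr (x * y) r = epowr x r * epowr y r"
proof (cases "x = top \<or> y = top")
  case True
  then show ?thesis
    by (auto simp: ennreal_top_mult ennreal_mult_top)
next
  case False
  then obtain a b where "x = ennreal a" "0 \<le> a" "y = ennreal b" "0 \<le> b"
    by (cases x; cases y) auto
  then show ?thesis
    by (simp add: epowr_ennreal powr_mult flip: ennreal_mult)
qed

lemma epowr_epowr: "epowr (epowr x r) s = epowr x (r * s)"
  by (cases x) (auto simp: epowr_ennreal powr_powr)

lemma epowr_add: "epowr x (r + s) = epowr x r * epowr x s"
  by (cases x) (auto simp: epowr_ennreal powr_add simp flip: ennreal_mult)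

lemma measurable_epowr [measurable (raw)]:
  assumes "f \<in> borel_measurable M"
  shows "(\<lambda>x. epowr (f x) r) \<in> borel_measurable M"
  using assms unfolding epowr_def by measurable

lemma epowr_inverse_le_iff:
  assumes "0 < r" "0 \<le> k"
  shows "epowr x (1 / r) \<le> ennreal k \<longleftrightarrow> x \<le> ennreal (k powr r)"
proof (cases x)
  case (real a)
  have "a powr (1 / r) \<le> k \<longleftrightarrow> a \<le> k powr r"
  proof
    assume "a powr (1 / r) \<le> k"
    then have "(a powr (1 / r)) powr r \<le> k powr r"
      using assms by (intro powr_mono2) auto
    then show "a \<le> k powr r"
      using assms real by (simp add: powr_powr)
  next
    assume "a \<le> k powr r"
    then have "a powr (1 / r) \<le> (k powr r) powr (1 / r)"
      using assms real by (intro powr_mono2) auto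
    then show "a powr (1 / r) \<le> k"
      using assms by (simp add: powr_powr)
  qed
  then show ?thesis
    using assms real by (simp add: epowr_ennreal)
next
  case top
  then show ?thesis
    by (simp add: top_unique)
qed

section \<open>Integrals over the half-line\<close>

text \<open>
  The spaces constrain functions on the half-line alone, while Tonelli's theorem is used on the whole
  line; cutting off by an indicator passes from one to the other.
\<close>

lemma halfline_measurable_extend:
  fixes f :: "real \<Rightarrow> real"
  assumes "f \<in> borel_measurable halfline"
  shows "(\<lambda>x. indicator {0<..} x * f x) \<in> borel_measurable lebesgue"
  using assms by (subst (asm) borel_measurable_restrict_space_iff) auto

lemma borel_measurable_lebesgue_on:
  fixes f :: "real \<Rightarrow> 'a::topological_space"
  assumes "f \<in> borel_measurable borel"
  shows "f \<in> borel_measurable (lebesgue_on A)"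
  using assms by (intro measurable_restrict_space1 measurable_completion) simp

lemma
  fixes r :: real
  shows borel_measurable_powr_lebesgue [measurable]: "(\<lambda>x. x powr r) \<in> borel_measurable lebesgue"
    and borel_measurable_powr_lebesgue_on [measurable]:
      "(\<lambda>x. x powr r) \<in> borel_measurable (lebesgue_on A)"
  by (rule measurable_completion, measurable) (rule borel_measurable_lebesgue_on, measurable)

lemma set_nn_integral_cong_AE_halfline:
  assumes "AE x in halfline. h x = h' x" and "0 \<le> t"
  shows "(\<integral>\<^sup>+x\<in>{t<..}. F (h x) x \<partial>lebesgue) = (\<integral>\<^sup>+x\<in>{t<..}. F (h' x) x \<partial>lebesgue)"
proof (rule nn_integral_cong_AE)
  have "AE x in lebesgue. x \<in> {0<..} \<longrightarrow> h x = h' x"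
    using assms by (subst (asm) AE_restrict_space_iff) auto
  then show "AE x in lebesgue. F (h x) x * indicator {t<..} x = F (h' x) x * indicator {t<..} x"
    by eventually_elim (use \<open>0 \<le> t\<close> in \<open>auto simp: indicator_def\<close>)
qed

lemma set_nn_integral_powr_tail:
  fixes t r :: real
  assumes "0 < t" "0 < r"
  shows "(\<integral>\<^sup>+x\<in>{t<..}. ennreal (x powr (- r - 1)) \<partial>lebesgue) = ennreal (t powr - r / r)"
proof -
  have "((\<lambda>x. x powr (- r - 1)) has_integral (t powr - r / r)) {t..}"
    using has_integral_powr_to_inf[of "- r - 1" t] assms by simp
  then have "(\<integral>\<^sup>+x\<in>{t..}. ennreal (x powr (- r - 1)) \<partial>lborel) = ennreal (t powr - r / r)"
    by (intro nn_integral_has_integral_lebesgue') auto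
  also have "(\<integral>\<^sup>+x\<in>{t..}. ennreal (x powr (- r - 1)) \<partial>lborel)
      = (\<integral>\<^sup>+x\<in>{t<..}. ennreal (x powr (- r - 1)) \<partial>lborel)"
    using AE_lborel_singleton[of t]
    by (intro nn_integral_cong_AE, eventually_elim) (auto simp: indicator_def)
  finally show ?thesis
    by (simp add: nn_integral_completion)
qed

lemma set_nn_integral_powr_from_0:
  fixes x r :: real
  assumes "0 \<le> x" "0 < r"
  shows "(\<integral>\<^sup>+t\<in>{0<..<x}. ennreal (t powr (r - 1)) \<partial>lebesgue) = ennreal (x powr r / r)"
proof -
  have "((\<lambda>x. x powr (r - 1)) has_integral (x powr r / r)) {0..x}"
    using has_integral_powr_from_0[of "r - 1" x] assms by simp
  then have "(\<integral>\<^sup>+t\<in>{0..x}. ennreal (t powr (r - 1)) \<partial>lborel) = ennreal (x powr r / r)"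
    by (intro nn_integral_has_integral_lebesgue') auto
  also have "(\<integral>\<^sup>+t\<in>{0..x}. ennreal (t powr (r - 1)) \<partial>lborel)
      = (\<integral>\<^sup>+t\<in>{0<..<x}. ennreal (t powr (r - 1)) \<partial>lborel)"
    using AE_lborel_singleton[of x] AE_lborel_singleton[of 0]
    by (intro nn_integral_cong_AE, eventually_elim) (auto simp: indicator_def)
  finally show ?thesis
    by (simp add: nn_integral_completion)
qed

lemma sigma_finite_lebesgue: "sigma_finite_measure (lebesgue :: real measure)"
proof
  obtain A :: "real set set" where A: "countable A" "A \<subseteq> sets lborel" "\<Union>A = space lborel"
      "\<forall>a\<in>A. emeasure lborel a \<noteq> \<infinity>"
    using lborel.sigma_finite_countable by blast
  then show "\<exists>A. countable A \<and> A \<subseteq> sets lebesgue \<and> \<Union>A = space lebesgue \<and>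
      (\<forall>a\<in>A. emeasure (lebesgue :: real measure) a \<noteq> \<infinity>)"
    by (intro exI[of _ A]) (auto simp: subset_iff)
qed

lemma measurable_tail_indicator:
  "(\<lambda>(t, x). indicator {t<..} x :: ennreal)
     \<in> borel_measurable ((lebesgue :: real measure) \<Otimes>\<^sub>M (lebesgue :: real measure))"
proof -
  have id: "(\<lambda>x. x) \<in> (lebesgue :: real measure) \<rightarrow>\<^sub>M borel"
    by (rule measurable_completion) simp
  have [measurable]: "Measurable.pred ((lebesgue :: real measure) \<Otimes>\<^sub>M (lebesgue :: real measure))
      (\<lambda>z. fst z < snd z)"
    by (intro borel_measurable_pred_less measurable_compose[OF measurable_fst id]
        measurable_compose[OF measurable_snd id])
  have "(\<lambda>(t :: real, x). indicator {t<..} x :: ennreal) = (\<lambda>z. if fst z < snd z then 1 else 0)"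
    by (auto simp: indicator_def)
  also have "\<dots> \<in> borel_measurable (lebesgue \<Otimes>\<^sub>M lebesgue)"
    by measurable
  finally show ?thesis .
qed

lemma borel_measurable_tail:
  assumes [measurable]: "G \<in> borel_measurable (lebesgue :: real measure)"
  shows "(\<lambda>t. \<integral>\<^sup>+x\<in>{t<..}. (G x :: ennreal) \<partial>lebesgue) \<in> borel_measurable lebesgue"
proof -
  interpret L: sigma_finite_measure "lebesgue :: real measure"
    by (rule sigma_finite_lebesgue)
  note measurable_tail_indicator[measurable]
  have "(\<lambda>z. G (snd z) * (case z of (t, x) \<Rightarrow> indicator {t<..} x))
      \<in> borel_measurable ((lebesgue :: real measure) \<Otimes>\<^sub>M (lebesgue :: real measure))"
    by measurable
  from L.borel_measurable_nn_integral_fst[OF this] show ?thesis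
    by simp
qed

text \<open>
  Tonelli on the region above the diagonal. It trades tails, by which both the Copson transform and
  the norm of \<open>G\<^sup>*\<close> are defined, for integrals over bounded intervals.
\<close>

lemma set_nn_integral_swap_triangle:
  fixes F G :: "real \<Rightarrow> ennreal"
  assumes [measurable]: "F \<in> borel_measurable lebesgue" "G \<in> borel_measurable lebesgue"
  shows "(\<integral>\<^sup>+t\<in>{a<..}. F t * (\<integral>\<^sup>+x\<in>{t<..}. G x \<partial>lebesgue) \<partial>lebesgue)
       = (\<integral>\<^sup>+x\<in>{a<..}. G x * (\<integral>\<^sup>+t\<in>{a<..<x}. F t \<partial>lebesgue) \<partial>lebesgue)"
proof -
  interpret P: pair_sigma_finite "lebesgue :: real measure" "lebesgue :: real measure"
    using sigma_finite_lebesgue by (simp add: pair_sigma_finite_def)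
  note measurable_tail_indicator[measurable]
  let ?k = "\<lambda>t x. F t * indicator {a<..} t * G x * indicator {t<..} x"
  have m: "case_prod ?k \<in> borel_measurable (lebesgue \<Otimes>\<^sub>M lebesgue)"
  proof -
    have "(\<lambda>z. F (fst z) * indicator {a<..} (fst z) * G (snd z) * (case z of (t, x) \<Rightarrow> indicator {t<..} x))
        \<in> borel_measurable ((lebesgue :: real measure) \<Otimes>\<^sub>M (lebesgue :: real measure))"
      by measurable
    then show ?thesis
      by (simp add: case_prod_beta')
  qed
  have "(\<integral>\<^sup>+t\<in>{a<..}. F t * (\<integral>\<^sup>+x\<in>{t<..}. G x \<partial>lebesgue) \<partial>lebesgue)
      = (\<integral>\<^sup>+t. \<integral>\<^sup>+x. ?k t x \<partial>lebesgue \<partial>lebesgue)"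
  proof (intro nn_integral_cong)
    fix t :: real
    have "(\<lambda>x. G x * indicator {t<..} x) \<in> borel_measurable lebesgue"
      by (intro borel_measurable_times_ennreal borel_measurable_indicator) auto
    then have "F t * indicator {a<..} t * (\<integral>\<^sup>+x\<in>{t<..}. G x \<partial>lebesgue)
        = (\<integral>\<^sup>+x. (F t * indicator {a<..} t) * (G x * indicator {t<..} x) \<partial>lebesgue)"
      by (rule nn_integral_cmult[symmetric])
    then show "F t * (\<integral>\<^sup>+x\<in>{t<..}. G x \<partial>lebesgue) * indicator {a<..} t
        = (\<integral>\<^sup>+x. ?k t x \<partial>lebesgue)"
      by (simp add: mult_ac)
  qed
  also have "\<dots> = (\<integral>\<^sup>+x. \<integral>\<^sup>+t. ?k t x \<partial>lebesgue \<partial>lebesgue)"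
    using P.Fubini'[OF m] by simp
  also have "\<dots> = (\<integral>\<^sup>+x\<in>{a<..}. G x * (\<integral>\<^sup>+t\<in>{a<..<x}. F t \<partial>lebesgue) \<partial>lebesgue)"
  proof (intro nn_integral_cong)
    fix x :: real
    have "(\<integral>\<^sup>+t. ?k t x \<partial>lebesgue)
        = (\<integral>\<^sup>+t. (G x * indicator {a<..} x) * (F t * indicator {a<..<x} t) \<partial>lebesgue)"
      by (intro nn_integral_cong) (auto simp: indicator_def mult_ac)
    also have "\<dots> = (G x * indicator {a<..} x) * (\<integral>\<^sup>+t\<in>{a<..<x}. F t \<partial>lebesgue)"
      by (intro nn_integral_cmult borel_measurable_times_ennreal borel_measurable_indicator) auto
    finally show "(\<integral>\<^sup>+t. ?k t x \<partial>lebesgue)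
        = G x * (\<integral>\<^sup>+t\<in>{a<..<x}. F t \<partial>lebesgue) * indicator {a<..} x"
      by (simp add: mult_ac)
  qed
  finally show ?thesis .
qed

text \<open>
  Hoelder's inequality raised to the power \<open>p\<close>, where \<open>p / q = p - 1\<close>. Infinite integrals
  are covered: if one factor on the right vanishes, then so does the integrand on the left almost
  everywhere, so the convention \<open>0 \<cdot> \<infinity> = 0\<close> does no harm.
\<close>

lemma nn_integral_Holder:
  fixes p q :: real
  assumes p: "1 < p" and q: "q = p / (p - 1)"
    and [measurable]: "u \<in> borel_measurable M" "v \<in> borel_measurable M"
    and nonneg: "\<And>x. 0 \<le> u x" "\<And>x. 0 \<le> v x"
  shows "epowr (\<integral>\<^sup>+x. ennreal (u x * v x) \<partial>M) p
     \<le> (\<integral>\<^sup>+x. ennreal (u x powr p) \<partial>M) * epowr (\<integral>\<^sup>+x. ennreal (v x powr q) \<partial>M) (p - 1)"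
    (is "epowr ?I p \<le> ?A * epowr ?B (p - 1)")
proof -
  have q1: "1 < q" and pq: "1 / p + 1 / q = 1"
    using p by (auto simp: q field_simps)
  (* In the last case, normalise both factors and integrate Young's inequality. *)
  consider "?A = 0" | "?B = 0" | "?A \<noteq> 0" "?B \<noteq> 0" "?A = top \<or> ?B = top"
    | "?A \<noteq> 0" "?B \<noteq> 0" "?A \<noteq> top" "?B \<noteq> top"
    by blast
  then show ?thesis
  proof cases
    case 1
    then have "AE x in M. u x = 0"
      by (subst (asm) nn_integral_0_iff_AE) (auto simp: ennreal_eq_0_iff)
    then have "?I = 0"
      by (subst nn_integral_0_iff_AE) auto
    then show ?thesis
      by simp
  next
    case 2
    then have "AE x in M. v x = 0"
      by (subst (asm) nn_integral_0_iff_AE) (auto simp: ennreal_eq_0_iff)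
    then have "?I = 0"
      by (subst nn_integral_0_iff_AE) auto
    then show ?thesis
      by simp
  next
    case 3
    then have "?A * epowr ?B (p - 1) = top"
      by (auto simp: ennreal_mult_eq_top_iff)
    then show ?thesis
      by simp
  next
    case 4
    then obtain a b where a: "?A = ennreal a" "0 < a" and b: "?B = ennreal b" "0 < b"
      by (cases ?A; cases ?B) (auto simp: less_le)
    define c where "c = a powr (1 / p) * b powr (1 / q)"
    have c: "0 \<le> c"
      by (simp add: c_def)
    have "?I \<le> (\<integral>\<^sup>+x. ennreal (c / (p * a)) * ennreal (u x powr p)
        + ennreal (c / (q * b)) * ennreal (v x powr q) \<partial>M)"
    proof (intro nn_integral_mono)
      fix x
      have "u x / a powr (1 / p) * (v x / b powr (1 / q))
          \<le> (u x / a powr (1 / p)) powr p / p + (v x / b powr (1 / q)) powr q / q"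
        using p q1 pq nonneg by (intro Youngs_inequality) auto
      also have "\<dots> = u x powr p / (p * a) + v x powr q / (q * b)"
        using p q1 a b nonneg by (simp add: powr_divide powr_powr mult.commute)
      finally have "c * (u x / a powr (1 / p) * (v x / b powr (1 / q)))
          \<le> c * (u x powr p / (p * a) + v x powr q / (q * b))"
        using c by (rule mult_left_mono)
      then have "u x * v x \<le> c / (p * a) * u x powr p + c / (q * b) * v x powr q"
        using a b by (simp add: c_def field_simps)
      then show "ennreal (u x * v x) \<le> ennreal (c / (p * a)) * ennreal (u x powr p)
          + ennreal (c / (q * b)) * ennreal (v x powr q)"
        using a b c p q1 by (simp add: ennreal_leI flip: ennreal_mult ennreal_plus)
    qed
    also have "\<dots> = ennreal (c / (p * a)) * ennreal a + ennreal (c / (q * b)) * ennreal b"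
      by (simp add: nn_integral_add nn_integral_cmult a b)
    also have "\<dots> = ennreal (c * (1 / p + 1 / q))"
      using a b c p q1 by (simp add: field_simps flip: ennreal_mult ennreal_plus)
    finally have "?I \<le> ennreal c"
      by (simp add: pq)
    then have "epowr ?I p \<le> epowr (ennreal c) p"
      using p by (intro epowr_mono) auto
    also have "\<dots> = ennreal (a * b powr (p - 1))"
    proof -
      have "p / q = p - 1"
        using p by (simp add: q)
      then show ?thesis
        using a b c p by (simp add: epowr_ennreal c_def powr_mult powr_powr)
    qed
    also have "\<dots> = ?A * epowr ?B (p - 1)"
      using a b by (simp add: epowr_ennreal ennreal_mult)
    finally show ?thesis .
  qed
qed

text \<open>
  A bound by the tails of the pure power \<open>x powr (- \<gamma> - 1)\<close> survives multiplication by an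
  increasing power, with the constant that the pure power itself would give. Writing \<open>x powr \<eta>\<close> as the integral of its derivative
  turns the left-hand side into a superposition, with nonnegative weights, of the tails \<open>(s, \<infinity>)\<close> with
  \<open>s > t\<close> and of the tail \<open>(t, \<infinity>)\<close> itself. This is the way in which membership in
  \<open>G\<^sup>*\<close>, a condition on tails, enters the estimate of a product.
\<close>

lemma set_nn_integral_tail_powr_le:
  fixes W :: "real \<Rightarrow> ennreal" and \<gamma> \<eta> K t :: real
  assumes [measurable]: "W \<in> borel_measurable lebesgue"
    and tail: "\<And>s. 0 < s \<Longrightarrow> (\<integral>\<^sup>+x\<in>{s<..}. W x \<partial>lebesgue) \<le> ennreal (K * s powr - \<gamma>)"
    and "0 \<le> K" "0 < \<eta>" "\<eta> < \<gamma>" "0 < t"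
  shows "(\<integral>\<^sup>+x\<in>{t<..}. W x * ennreal (x powr \<eta>) \<partial>lebesgue)
     \<le> ennreal (K * \<gamma> / (\<gamma> - \<eta>) * t powr (\<eta> - \<gamma>))"
proof -
  have [measurable]: "(\<lambda>x. x) \<in> (lebesgue :: real measure) \<rightarrow>\<^sub>M borel"
    by (rule measurable_completion) simp
  let ?F = "\<lambda>s. ennreal (\<eta> * s powr (\<eta> - 1))"
  have "(\<integral>\<^sup>+x\<in>{t<..}. W x * ennreal (x powr \<eta>) \<partial>lebesgue)
      = (\<integral>\<^sup>+x\<in>{0<..}. (W x * indicator {t<..} x) * (\<integral>\<^sup>+s\<in>{0<..<x}. ?F s \<partial>lebesgue) \<partial>lebesgue)"
  proof (intro nn_integral_cong)
    fix x :: real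
    have "(\<integral>\<^sup>+s\<in>{0<..<x}. ?F s \<partial>lebesgue) = ennreal (x powr \<eta>)" if "0 < x"
    proof -
      have "(\<integral>\<^sup>+s\<in>{0<..<x}. ?F s \<partial>lebesgue)
          = ennreal \<eta> * (\<integral>\<^sup>+s\<in>{0<..<x}. ennreal (s powr (\<eta> - 1)) \<partial>lebesgue)"
        using assms by (subst nn_integral_cmult[symmetric]) (auto simp: ennreal_mult mult_ac)
      also have "\<dots> = ennreal (x powr \<eta>)"
        using assms that by (subst set_nn_integral_powr_from_0) (auto simp flip: ennreal_mult)
      finally show ?thesis .
    qed
    then show "W x * ennreal (x powr \<eta>) * indicator {t<..} x
        = (W x * indicator {t<..} x) * (\<integral>\<^sup>+s\<in>{0<..<x}. ?F s \<partial>lebesgue) * indicator {0<..} x"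
      using \<open>0 < t\<close> by (auto simp: indicator_def)
  qed
  also have "\<dots> = (\<integral>\<^sup>+s\<in>{0<..}. ?F s * (\<integral>\<^sup>+x\<in>{s<..}. W x * indicator {t<..} x \<partial>lebesgue) \<partial>lebesgue)"
    by (rule set_nn_integral_swap_triangle[symmetric]) measurable
  also have "\<dots> \<le> (\<integral>\<^sup>+s. ennreal (\<eta> * K * t powr - \<gamma>) * (ennreal (s powr (\<eta> - 1)) * indicator {0<..<t} s)
      + ennreal (\<eta> * K) * (ennreal (s powr (- (\<gamma> - \<eta>) - 1)) * indicator {t<..} s) \<partial>lebesgue)"
  proof (intro nn_integral_mono_AE)
    have "AE s in lebesgue. s \<noteq> t"
      by (intro AE_completion AE_lborel_singleton)
    then show "AE s in lebesgue. ?F s * (\<integral>\<^sup>+x\<in>{s<..}. W x * indicator {t<..} x \<partial>lebesgue) * indicator {0<..} s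
        \<le> ennreal (\<eta> * K * t powr - \<gamma>) * (ennreal (s powr (\<eta> - 1)) * indicator {0<..<t} s)
      + ennreal (\<eta> * K) * (ennreal (s powr (- (\<gamma> - \<eta>) - 1)) * indicator {t<..} s)"
    proof eventually_elim
      case (elim s)
      consider "s \<le> 0" | "0 < s" "s < t" | "t < s"
        using elim by linarith
      then show ?case
      proof cases
        case 1
        then show ?thesis by simp
      next
        case 2
        have "(\<integral>\<^sup>+x\<in>{s<..}. W x * indicator {t<..} x \<partial>lebesgue) \<le> (\<integral>\<^sup>+x\<in>{t<..}. W x \<partial>lebesgue)"
          by (intro nn_integral_mono) (auto simp: indicator_def)
        also have "\<dots> \<le> ennreal (K * t powr - \<gamma>)"
          using tail \<open>0 < t\<close> by blast
        finally have "?F s * (\<integral>\<^sup>+x\<in>{s<..}. W x * indicator {t<..} x \<partial>lebesgue)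
            \<le> ?F s * ennreal (K * t powr - \<gamma>)"
          by (rule mult_left_mono) simp
        also have "\<dots> = ennreal (\<eta> * K * t powr - \<gamma>) * ennreal (s powr (\<eta> - 1))"
          using assms by (simp add: mult_ac flip: ennreal_mult)
        finally show ?thesis
          using 2 by simp
      next
        case 3
        have "(\<integral>\<^sup>+x\<in>{s<..}. W x * indicator {t<..} x \<partial>lebesgue) \<le> (\<integral>\<^sup>+x\<in>{s<..}. W x \<partial>lebesgue)"
          by (intro nn_integral_mono) (auto simp: indicator_def)
        also have "\<dots> \<le> ennreal (K * s powr - \<gamma>)"
          using tail \<open>0 < t\<close> 3 by simp
        finally have "?F s * (\<integral>\<^sup>+x\<in>{s<..}. W x * indicator {t<..} x \<partial>lebesgue)
            \<le> ?F s * ennreal (K * s powr - \<gamma>)"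
          by (rule mult_left_mono) simp
        also have "\<dots> = ennreal (\<eta> * K * (s powr (\<eta> - 1) * s powr - \<gamma>))"
          using assms by (simp add: mult_ac flip: ennreal_mult)
        also have "s powr (\<eta> - 1) * s powr - \<gamma> = s powr (- (\<gamma> - \<eta>) - 1)"
          by (simp add: algebra_simps flip: powr_add)
        finally show ?thesis
          using 3 assms by (simp add: ennreal_mult)
      qed
    qed
  qed
  also have "\<dots> = ennreal (\<eta> * K * t powr - \<gamma>) * ennreal (t powr \<eta> / \<eta>)
      + ennreal (\<eta> * K) * ennreal (t powr - (\<gamma> - \<eta>) / (\<gamma> - \<eta>))"
    using assms
    by (simp add: nn_integral_add nn_integral_cmult set_nn_integral_powr_from_0
        set_nn_integral_powr_tail del: minus_diff_eq)
  also have "\<dots> = ennreal (K * (t powr - \<gamma> * t powr \<eta>) + \<eta> * K * (t powr (\<eta> - \<gamma>) / (\<gamma> - \<eta>)))"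
    using assms by (simp add: field_simps flip: ennreal_mult ennreal_plus)
  also have "t powr - \<gamma> * t powr \<eta> = t powr (\<eta> - \<gamma>)"
    by (simp flip: powr_add)
  also have "K * t powr (\<eta> - \<gamma>) + \<eta> * K * (t powr (\<eta> - \<gamma>) / (\<gamma> - \<eta>))
      = K * \<gamma> / (\<gamma> - \<eta>) * t powr (\<eta> - \<gamma>)"
    using assms by (simp add: field_simps)
  finally show ?thesis .
qed

section \<open>The Copson transform and the exponents\<close>

definition copson :: "(real \<Rightarrow> real) \<Rightarrow> real \<Rightarrow> ennreal" where
  "copson h t = (\<integral>\<^sup>+x\<in>{t<..}. ennreal (\<bar>h x\<bar> / x) \<partial>lebesgue)"

text \<open>
  The integrand can be cut off at \<open>0\<close> for every \<open>t\<close>, since for negative \<open>x\<close> the quotient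
  \<open>\<bar>h x\<bar> / x\<close> is nonpositive and \<^const>\<open>ennreal\<close> sends it to \<open>0\<close>.
\<close>

lemma copson_eq_tail:
  "copson h t = (\<integral>\<^sup>+x\<in>{t<..}. ennreal (indicator {0<..} x * (\<bar>h x\<bar> / x)) \<partial>lebesgue)"
  unfolding copson_def
  by (intro nn_integral_cong) (auto simp: indicator_def ennreal_neg divide_nonneg_nonpos)

lemma
  assumes "h \<in> borel_measurable halfline"
  shows borel_measurable_copson_density:
      "(\<lambda>x. ennreal (indicator {0<..} x * (\<bar>h x\<bar> / x))) \<in> borel_measurable lebesgue"
    and borel_measurable_copson: "copson h \<in> borel_measurable lebesgue"
proof -
  note assms[measurable]
  have [measurable]: "(\<lambda>x :: real. x) \<in> borel_measurable halfline"
    by (rule borel_measurable_lebesgue_on) measurable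
  show *: "(\<lambda>x. ennreal (indicator {0<..} x * (\<bar>h x\<bar> / x))) \<in> borel_measurable lebesgue"
    by (intro measurable_compose[OF _ measurable_ennreal] halfline_measurable_extend) measurable
  show "copson h \<in> borel_measurable lebesgue"
    using borel_measurable_tail[OF *] by (simp add: copson_eq_tail[abs_def])
qed

lemma copson_antimono: "s \<le> t \<Longrightarrow> copson h t \<le> copson h s"
  unfolding copson_def by (intro nn_integral_mono) (auto simp: indicator_def)

lemma Cop_norm_eq:
  "Cop_norm p \<alpha> h = epowr (\<integral>\<^sup>+t\<in>{0<..}. epowr (copson h t) p * ennreal (t powr \<alpha>) \<partial>lebesgue) (1 / p)"
  by (simp add: Cop_norm_def copson_def)

locale copson_exponents =
  fixes p q \<alpha> :: real
  assumes p: "1 < p" and q: "q = p / (p - 1)" and \<alpha>: "- 1 < \<alpha>"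
begin

text \<open>
  Two exponents organise the computations: \<open>x powr - \<delta>\<close> is the borderline power for
  \<open>L\<^sup>p\<close>, and the weight defining \<open>G\<^sup>*\<close> is \<open>x powr (- \<gamma> - 1)\<close>, whose tail at \<open>t\<close> is
  \<open>t powr - \<gamma> / \<gamma>\<close>.
\<close>

definition \<delta> :: real where "\<delta> = (\<alpha> + 1) / p"

definition \<gamma> :: real where "\<gamma> = (\<alpha> + 1) / (p - 1)"

lemma \<delta>_pos: "0 < \<delta>" and \<gamma>_pos: "0 < \<gamma>" and q_gt_1: "1 < q"
  using p \<alpha> by (auto simp: \<delta>_def \<gamma>_def q field_simps)

lemma conjugate_exponents: "1 / p + 1 / q = 1" "p / q = p - 1"
  using p by (auto simp: q field_simps)

lemma Gstar_exponent: "\<alpha> * (1 - q) - q = - \<gamma> - 1"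
proof -
  have "q = 1 + 1 / (p - 1)"
    using p by (simp add: q field_simps)
  then show ?thesis
    by (simp add: \<gamma>_def add_divide_distrib)
qed

lemma Gstar_norm_le_iff:
  assumes "0 \<le> k"
  shows "Gstar_norm q (\<alpha> * (1 - q)) g \<le> ennreal k \<longleftrightarrow>
    (\<forall>t>0. (\<integral>\<^sup>+x\<in>{t<..}. ennreal (\<bar>g x\<bar> powr q * x powr (- \<gamma> - 1)) \<partial>lebesgue)
       \<le> ennreal (k powr q / \<gamma> * t powr - \<gamma>))"
proof -
  have "epowr (1 / (\<integral>\<^sup>+x\<in>{t<..}. ennreal (x powr (- \<gamma> - 1)) \<partial>lebesgue) * J) (1 / q) \<le> ennreal k
      \<longleftrightarrow> J \<le> ennreal (k powr q / \<gamma> * t powr - \<gamma>)" if "0 < t" for t and J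
  proof -
    define d where "d = t powr - \<gamma> / \<gamma>"
    have d: "0 < d"
      using that \<gamma>_pos by (simp add: d_def)
    have "epowr (1 / ennreal d * J) (1 / q) \<le> ennreal k \<longleftrightarrow> 1 / ennreal d * J \<le> ennreal (k powr q)"
      using assms q_gt_1 by (intro epowr_inverse_le_iff) auto
    also have "\<dots> \<longleftrightarrow> ennreal (1 / d) * J \<le> ennreal (k powr q)"
      using d by (simp add: divide_ennreal flip: ennreal_1)
    also have "\<dots> \<longleftrightarrow> J \<le> ennreal (k powr q * d)"
      using d by (cases J) (auto simp: ennreal_mult_top top_unique field_simps simp flip: ennreal_mult)
    also have "k powr q * d = k powr q / \<gamma> * t powr - \<gamma>"
      by (simp add: d_def)
    finally show ?thesis
      by (simp only: set_nn_integral_powr_tail[OF that \<gamma>_pos] d_def)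
  qed
  then show ?thesis
    unfolding Gstar_norm_def Gstar_exponent by (auto simp: SUP_le_iff)
qed

section \<open>A product of functions lies in the Copson space\<close>

text \<open>
  Hoelder's inequality for \<open>\<bar>f g\<bar> / x = (\<bar>f\<bar> x powr (a / p)) (\<bar>g\<bar> x powr (- 1 - a / p))\<close>. The
  splitting exponent is left free: \<open>a = \<alpha>\<close> produces exactly the two weights of the norms, whereas the
  norm estimate below shifts \<open>a\<close> so that the outer integral converges.
\<close>

lemma copson_mult_Holder:
  assumes f: "f \<in> borel_measurable halfline" and g: "g \<in> borel_measurable halfline"
    and h: "AE x in halfline. h x = f x * g x" and "0 \<le> t"
    and b: "b = - (p + a) / (p - 1)"
  shows "epowr (copson h t) p
    \<le> (\<integral>\<^sup>+x\<in>{t<..}. ennreal (\<bar>f x\<bar> powr p * x powr a) \<partial>lebesgue)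
      * epowr (\<integral>\<^sup>+x\<in>{t<..}. ennreal (\<bar>g x\<bar> powr q * x powr b) \<partial>lebesgue) (p - 1)"
proof -
  let ?M = "lebesgue_on {t<..}"
  have sub: "f' \<in> borel_measurable ?M" if "f' \<in> borel_measurable halfline" for f' :: "real \<Rightarrow> real"
    using \<open>0 \<le> t\<close> by (intro measurable_restrict_mono[OF that]) auto
  note [measurable] = sub[OF f] sub[OF g]
  have set_int: "(\<integral>\<^sup>+x. F x \<partial>?M) = (\<integral>\<^sup>+x\<in>{t<..}. F x \<partial>lebesgue)" for F
    by (rule nn_integral_restrict_space) simp
  have "copson h t = (\<integral>\<^sup>+x\<in>{t<..}. ennreal (\<bar>f x * g x\<bar> / x) \<partial>lebesgue)"
    unfolding copson_def using set_nn_integral_cong_AE_halfline[OF h \<open>0 \<le> t\<close>] .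
  also have "\<dots> = (\<integral>\<^sup>+x. ennreal (\<bar>f x\<bar> * x powr (a / p) * (\<bar>g x\<bar> * x powr (- 1 - a / p))) \<partial>?M)"
  proof (subst set_int, intro nn_integral_cong)
    fix x :: real
    have "\<bar>f x * g x\<bar> / x = \<bar>f x\<bar> * x powr (a / p) * (\<bar>g x\<bar> * x powr (- 1 - a / p))" if "0 < x"
    proof -
      have "x powr (a / p) * x powr (- 1 - a / p) = x powr - 1"
        by (simp flip: powr_add)
      also have "\<dots> = 1 / x"
        using that by (simp add: powr_minus_divide)
      finally have "\<bar>f x\<bar> * \<bar>g x\<bar> * (x powr (a / p) * x powr (- 1 - a / p)) = \<bar>f x\<bar> * \<bar>g x\<bar> * (1 / x)"
        by simp
      then show ?thesis
        by (simp add: abs_mult mult_ac)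
    qed
    then show "ennreal (\<bar>f x * g x\<bar> / x) * indicator {t<..} x
        = ennreal (\<bar>f x\<bar> * x powr (a / p) * (\<bar>g x\<bar> * x powr (- 1 - a / p))) * indicator {t<..} x"
      using \<open>0 \<le> t\<close> by (simp add: indicator_def)
  qed
  finally have "epowr (copson h t) p
      \<le> (\<integral>\<^sup>+x. ennreal ((\<bar>f x\<bar> * x powr (a / p)) powr p) \<partial>?M)
        * epowr (\<integral>\<^sup>+x. ennreal ((\<bar>g x\<bar> * x powr (- 1 - a / p)) powr q) \<partial>?M) (p - 1)"
    by (simp only:) (rule nn_integral_Holder[OF p q]; simp)
  also have "(\<lambda>x. (\<bar>f x\<bar> * x powr (a / p)) powr p) = (\<lambda>x. \<bar>f x\<bar> powr p * x powr a)"
    using p by (simp add: powr_mult powr_powr)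
  also have "(\<lambda>x. (\<bar>g x\<bar> * x powr (- 1 - a / p)) powr q) = (\<lambda>x. \<bar>g x\<bar> powr q * x powr b)"
  proof -
    have "(- 1 - a / p) * q = b"
      using p by (simp add: b q field_simps)
    then show ?thesis
      by (simp add: powr_mult powr_powr)
  qed
  finally show ?thesis
    by (simp add: set_int)
qed

text \<open>
  For \<open>g = 1\<close> this is Copson's form of Hardy's inequality, and Schur's proof of it carries over: apply
  Hoelder's inequality with \<open>a = \<alpha> - \<delta>\<close>, bound the factor containing \<open>g\<close> by
  \<open>set_nn_integral_tail_powr_le\<close>, and interchange the integrations that remain. Shifting \<open>a\<close> to
  \<open>\<alpha> - (p - 1) \<eta>\<close> yields, besides \<open>k powr p\<close>, the constant
  \<open>(\<gamma> - \<eta>) powr (1 - p) / ((p - 1) \<eta>)\<close> for the \<open>p\<close>-th powers;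
  it is smallest at \<open>\<eta> = \<gamma> / p = \<delta> / (p - 1)\<close>, where it equals \<open>\<delta> powr - p\<close>.
\<close>

lemma Cop_norm_mult_le:
  assumes f: "f \<in> borel_measurable halfline" and g: "g \<in> borel_measurable halfline"
    and h: "AE x in halfline. h x = f x * g x"
    and k: "Gstar_norm q (\<alpha> * (1 - q)) g \<le> ennreal k" "0 \<le> k"
  shows "Cop_norm p \<alpha> h \<le> ennreal (p / (\<alpha> + 1)) * (Lp_norm p \<alpha> f * ennreal k)"
proof -
  \<comment> \<open>Equivalently \<open>\<eta> = \<gamma> / p\<close>, the minimiser of the constant.\<close>
  define \<eta> where "\<eta> = \<delta> / (p - 1)"
  have \<eta>: "0 < \<eta>" "\<eta> < \<gamma>" "\<gamma> - \<eta> = \<delta>"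
  proof -
    show "0 < \<eta>"
      using p \<delta>_pos by (simp add: \<eta>_def)
    have "\<gamma> = p * \<eta>"
      using p by (simp add: \<eta>_def \<gamma>_def \<delta>_def)
    then have "\<gamma> - \<eta> = (p - 1) * \<eta>"
      by (simp add: algebra_simps)
    also have "\<dots> = \<delta>"
      using p by (simp add: \<eta>_def)
    finally show "\<gamma> - \<eta> = \<delta>" .
    then show "\<eta> < \<gamma>"
      using \<delta>_pos by simp
  qed
  note f[measurable] g[measurable]
  define W where "W x = ennreal (indicator {0<..} x * (\<bar>g x\<bar> powr q * x powr (- \<gamma> - 1)))" for x
  define F where "F x = ennreal (indicator {0<..} x * (\<bar>f x\<bar> powr p * x powr (\<alpha> - \<delta>)))" for x
  have W_meas: "W \<in> borel_measurable lebesgue"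
    unfolding W_def by (intro measurable_compose[OF _ measurable_ennreal] halfline_measurable_extend) measurable
  have F_meas: "F \<in> borel_measurable lebesgue"
    unfolding F_def by (intro measurable_compose[OF _ measurable_ennreal] halfline_measurable_extend) measurable
  define C where "C = k powr p * \<delta> powr (1 - p)"
  have C: "0 \<le> C"
    by (simp add: C_def)
  have pointwise: "epowr (copson h t) p * ennreal (t powr \<alpha>)
      \<le> ennreal C * (ennreal (t powr (\<delta> - 1)) * (\<integral>\<^sup>+x\<in>{t<..}. F x \<partial>lebesgue))" if "0 < t" for t
  proof -
    let ?B = "\<integral>\<^sup>+x\<in>{t<..}. ennreal (\<bar>g x\<bar> powr q * x powr (\<eta> - \<gamma> - 1)) \<partial>lebesgue"
    have "?B = (\<integral>\<^sup>+x\<in>{t<..}. W x * ennreal (x powr \<eta>) \<partial>lebesgue)"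
    proof (intro nn_integral_cong)
      fix x :: real
      have "x powr (\<eta> - \<gamma> - 1) = x powr (- \<gamma> - 1) * x powr \<eta>"
        by (simp add: algebra_simps flip: powr_add)
      then show "ennreal (\<bar>g x\<bar> powr q * x powr (\<eta> - \<gamma> - 1)) * indicator {t<..} x
          = W x * ennreal (x powr \<eta>) * indicator {t<..} x"
        using that by (simp add: W_def indicator_def flip: ennreal_mult)
    qed
    also have "\<dots> \<le> ennreal (k powr q / \<gamma> * \<gamma> / (\<gamma> - \<eta>) * t powr (\<eta> - \<gamma>))"
    proof (rule set_nn_integral_tail_powr_le[OF W_meas])
      fix s :: real assume "0 < s"
      then have "(\<integral>\<^sup>+x\<in>{s<..}. W x \<partial>lebesgue)
          = (\<integral>\<^sup>+x\<in>{s<..}. ennreal (\<bar>g x\<bar> powr q * x powr (- \<gamma> - 1)) \<partial>lebesgue)"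
        by (intro nn_integral_cong) (auto simp: W_def indicator_def)
      also have "\<dots> \<le> ennreal (k powr q / \<gamma> * s powr - \<gamma>)"
        using k \<open>0 < s\<close> by (simp add: Gstar_norm_le_iff)
      finally show "(\<integral>\<^sup>+x\<in>{s<..}. W x \<partial>lebesgue) \<le> ennreal (k powr q / \<gamma> * s powr - \<gamma>)" .
    qed (use \<eta> \<gamma>_pos that in auto)
    also have "k powr q / \<gamma> * \<gamma> / (\<gamma> - \<eta>) * t powr (\<eta> - \<gamma>) = k powr q / \<delta> * t powr - \<delta>"
      using \<eta> \<gamma>_pos by (simp flip: \<open>\<gamma> - \<eta> = \<delta>\<close>)
    finally have "epowr ?B (p - 1) \<le> epowr (ennreal (k powr q / \<delta> * t powr - \<delta>)) (p - 1)"
      using p by (intro epowr_mono) auto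
    also have "\<dots> = ennreal (C * t powr (- \<delta> * (p - 1)))"
    proof -
      have "q * (p - 1) = p"
        using p by (simp add: q)
      then have "(k powr q / \<delta> * t powr - \<delta>) powr (p - 1) = k powr p / \<delta> powr (p - 1) * t powr (- \<delta> * (p - 1))"
        using \<delta>_pos by (simp add: powr_mult powr_divide powr_powr)
      also have "\<dots> = C * t powr (- \<delta> * (p - 1))"
        using \<delta>_pos by (simp add: C_def powr_diff)
      finally show ?thesis
        using \<delta>_pos by (subst epowr_ennreal) auto
    qed
    finally have B: "epowr ?B (p - 1) \<le> ennreal (C * t powr (- \<delta> * (p - 1)))" .
    have "epowr (copson h t) p
        \<le> (\<integral>\<^sup>+x\<in>{t<..}. ennreal (\<bar>f x\<bar> powr p * x powr (\<alpha> - \<delta>)) \<partial>lebesgue) * epowr ?B (p - 1)"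
    proof (rule copson_mult_Holder[OF f g h])
      show "\<eta> - \<gamma> - 1 = - (p + (\<alpha> - \<delta>)) / (p - 1)"
      proof -
        have "p + (\<alpha> - \<delta>) = (p - 1) * (1 + \<delta>)"
          using p by (simp add: \<delta>_def field_simps)
        then show ?thesis
          using p \<eta>(3) by (simp add: minus_divide_left[symmetric])
      qed
    qed (use that in simp)
    also have "(\<integral>\<^sup>+x\<in>{t<..}. ennreal (\<bar>f x\<bar> powr p * x powr (\<alpha> - \<delta>)) \<partial>lebesgue)
        = (\<integral>\<^sup>+x\<in>{t<..}. F x \<partial>lebesgue)"
      using that by (intro nn_integral_cong) (auto simp: F_def indicator_def)
    finally have "epowr (copson h t) p * ennreal (t powr \<alpha>)
        \<le> (\<integral>\<^sup>+x\<in>{t<..}. F x \<partial>lebesgue) * ennreal (C * t powr (- \<delta> * (p - 1))) * ennreal (t powr \<alpha>)"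
      using B by (meson mult_left_mono mult_right_mono order_trans zero_le)
    also have "\<dots> = (\<integral>\<^sup>+x\<in>{t<..}. F x \<partial>lebesgue)
        * ennreal (C * (t powr (- \<delta> * (p - 1)) * t powr \<alpha>))"
      using C by (simp add: mult.assoc flip: ennreal_mult)
    also have "t powr (- \<delta> * (p - 1)) * t powr \<alpha> = t powr (\<delta> - 1)"
    proof -
      have "- \<delta> * (p - 1) + \<alpha> = \<delta> - 1"
        using p by (simp add: \<delta>_def field_simps)
      then show ?thesis
        by (simp only: powr_add[symmetric])
    qed
    finally show ?thesis
      using C by (simp add: ennreal_mult mult_ac)
  qed
  have "(\<integral>\<^sup>+t\<in>{0<..}. epowr (copson h t) p * ennreal (t powr \<alpha>) \<partial>lebesgue)
      \<le> (\<integral>\<^sup>+t. ennreal C * (ennreal (t powr (\<delta> - 1)) * (\<integral>\<^sup>+x\<in>{t<..}. F x \<partial>lebesgue) * indicator {0<..} t) \<partial>lebesgue)"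
    using pointwise by (intro nn_integral_mono) (auto simp: indicator_def)
  also have "\<dots> = ennreal C * (\<integral>\<^sup>+t\<in>{0<..}. ennreal (t powr (\<delta> - 1)) * (\<integral>\<^sup>+x\<in>{t<..}. F x \<partial>lebesgue) \<partial>lebesgue)"
    using borel_measurable_tail[OF F_meas]
    by (intro nn_integral_cmult borel_measurable_times_ennreal borel_measurable_indicator) auto
  also have "(\<integral>\<^sup>+t\<in>{0<..}. ennreal (t powr (\<delta> - 1)) * (\<integral>\<^sup>+x\<in>{t<..}. F x \<partial>lebesgue) \<partial>lebesgue)
      = (\<integral>\<^sup>+x\<in>{0<..}. F x * (\<integral>\<^sup>+t\<in>{0<..<x}. ennreal (t powr (\<delta> - 1)) \<partial>lebesgue) \<partial>lebesgue)"
    using F_meas by (intro set_nn_integral_swap_triangle) auto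
  also have "\<dots> = (\<integral>\<^sup>+x. ennreal (1 / \<delta>) * (ennreal (indicator {0<..} x * (\<bar>f x\<bar> powr p * x powr \<alpha>))) \<partial>lebesgue)"
  proof (intro nn_integral_cong)
    fix x :: real
    have "x powr (\<alpha> - \<delta>) * x powr \<delta> = x powr \<alpha>"
      by (simp flip: powr_add)
    then have "\<bar>f x\<bar> powr p * x powr (\<alpha> - \<delta>) * (x powr \<delta> / \<delta>) = 1 / \<delta> * (\<bar>f x\<bar> powr p * x powr \<alpha>)"
      by (simp add: mult.assoc)
    then show "F x * (\<integral>\<^sup>+t\<in>{0<..<x}. ennreal (t powr (\<delta> - 1)) \<partial>lebesgue) * indicator {0<..} x
        = ennreal (1 / \<delta>) * (ennreal (indicator {0<..} x * (\<bar>f x\<bar> powr p * x powr \<alpha>)))"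
      using \<delta>_pos
      by (cases "0 < x") (simp_all add: F_def set_nn_integral_powr_from_0 flip: ennreal_mult)
  qed
  also have "\<dots> = ennreal (1 / \<delta>) * (\<integral>\<^sup>+x. ennreal (indicator {0<..} x * (\<bar>f x\<bar> powr p * x powr \<alpha>)) \<partial>lebesgue)"
    by (intro nn_integral_cmult measurable_compose[OF _ measurable_ennreal] halfline_measurable_extend) measurable
  also have "(\<integral>\<^sup>+x. ennreal (indicator {0<..} x * (\<bar>f x\<bar> powr p * x powr \<alpha>)) \<partial>lebesgue)
      = (\<integral>\<^sup>+x\<in>{0<..}. ennreal (\<bar>f x\<bar> powr p * x powr \<alpha>) \<partial>lebesgue)"
    by (intro nn_integral_cong) (auto simp: indicator_def)
  finally have "Cop_norm p \<alpha> h \<le> epowr (ennreal C * (ennreal (1 / \<delta>)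
      * (\<integral>\<^sup>+x\<in>{0<..}. ennreal (\<bar>f x\<bar> powr p * x powr \<alpha>) \<partial>lebesgue))) (1 / p)"
    unfolding Cop_norm_eq using p by (intro epowr_mono) auto
  also have "\<dots> = ennreal (C powr (1 / p) * (1 / \<delta>) powr (1 / p)) * Lp_norm p \<alpha> f"
    using C \<delta>_pos by (simp add: epowr_mult epowr_ennreal Lp_norm_def ennreal_mult mult_ac)
  also have "C powr (1 / p) * (1 / \<delta>) powr (1 / p) = p / (\<alpha> + 1) * k"
  proof -
    have "C * (1 / \<delta>) = (k / \<delta>) powr p"
      using \<delta>_pos k by (simp add: C_def powr_divide powr_diff)
    then have "C powr (1 / p) * (1 / \<delta>) powr (1 / p) = ((k / \<delta>) powr p) powr (1 / p)"
      using C \<delta>_pos by (simp add: powr_mult[symmetric])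
    also have "\<dots> = p / (\<alpha> + 1) * k"
      using p \<alpha> k \<delta>_pos by (simp add: powr_powr \<delta>_def)
    finally show ?thesis .
  qed
  also have "ennreal (p / (\<alpha> + 1) * k) * Lp_norm p \<alpha> f = ennreal (p / (\<alpha> + 1)) * (Lp_norm p \<alpha> f * ennreal k)"
    using p \<alpha> k by (subst ennreal_mult) (auto simp: mult_ac)
  finally show ?thesis .
qed

section \<open>Factoring a function of the Copson space\<close>

text \<open>
  The Copson transform is decreasing, so its value at \<open>t\<close> is a lower bound on \<open>(0, t)\<close>.
\<close>

lemma copson_powr_le_integral:
  assumes "0 < t" "0 \<le> r"
  shows "epowr (copson h t) r * ennreal (t powr (\<alpha> + 1) / (\<alpha> + 1))
    \<le> (\<integral>\<^sup>+\<tau>\<in>{0<..<t}. epowr (copson h \<tau>) r * ennreal (\<tau> powr \<alpha>) \<partial>lebesgue)"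
proof -
  have "epowr (copson h t) r * ennreal (t powr (\<alpha> + 1) / (\<alpha> + 1))
      = epowr (copson h t) r * (\<integral>\<^sup>+\<tau>\<in>{0<..<t}. ennreal (\<tau> powr \<alpha>) \<partial>lebesgue)"
    using set_nn_integral_powr_from_0[of t "\<alpha> + 1"] assms \<alpha> by simp
  also have "\<dots> = (\<integral>\<^sup>+\<tau>. epowr (copson h t) r * (ennreal (\<tau> powr \<alpha>) * indicator {0<..<t} \<tau>) \<partial>lebesgue)"
    by (intro nn_integral_cmult[symmetric] borel_measurable_times_ennreal borel_measurable_indicator) auto
  also have "\<dots> \<le> (\<integral>\<^sup>+\<tau>\<in>{0<..<t}. epowr (copson h \<tau>) r * ennreal (\<tau> powr \<alpha>) \<partial>lebesgue)"
    using assms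
    by (intro nn_integral_mono)
      (auto simp: indicator_def intro!: mult_right_mono epowr_mono copson_antimono)
  finally show ?thesis .
qed

lemma copson_finite:
  assumes "Cop_norm p \<alpha> h < \<infinity>" "0 < t"
  shows "copson h t < top"
proof -
  have "epowr (copson h t) p * ennreal (t powr (\<alpha> + 1) / (\<alpha> + 1))
      \<le> (\<integral>\<^sup>+\<tau>\<in>{0<..<t}. epowr (copson h \<tau>) p * ennreal (\<tau> powr \<alpha>) \<partial>lebesgue)"
    using assms p by (intro copson_powr_le_integral) auto
  also have "\<dots> \<le> (\<integral>\<^sup>+\<tau>\<in>{0<..}. epowr (copson h \<tau>) p * ennreal (\<tau> powr \<alpha>) \<partial>lebesgue)"
    by (intro nn_integral_mono) (auto simp: indicator_def)
  also have "\<dots> < top"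
    using assms by (simp add: Cop_norm_eq)
  finally have "epowr (copson h t) p * ennreal (t powr (\<alpha> + 1) / (\<alpha> + 1)) < top" .
  moreover have "0 < t powr (\<alpha> + 1) / (\<alpha> + 1)"
    using assms \<alpha> by simp
  ultimately have "epowr (copson h t) p < top"
    by (auto simp: less_top[symmetric] ennreal_mult_eq_top_iff ennreal_eq_0_iff)
  then show ?thesis
    by simp
qed

text \<open>
  Up to the factor \<open>\<alpha> + 1\<close>, this is an increasing function that dominates
  \<open>copson h x powr (p - 1) * x powr (\<alpha> + 1)\<close>. These two properties give the bound for the right
  factor, and its being an integral over \<open>(0, x)\<close> makes the norm of the left factor computable by
  Tonelli's theorem.
\<close>

definition potential :: "(real \<Rightarrow> real) \<Rightarrow> real \<Rightarrow> ennreal" where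
  "potential h x = (\<integral>\<^sup>+\<tau>\<in>{0<..<x}. epowr (copson h \<tau>) (p - 1) * ennreal (\<tau> powr \<alpha>) \<partial>lebesgue)"

lemma potential_mono: "x \<le> y \<Longrightarrow> potential h x \<le> potential h y"
  unfolding potential_def by (intro nn_integral_mono) (auto simp: indicator_def)

text \<open>
  Near \<open>0\<close> the weight \<open>\<tau> powr \<alpha>\<close> is integrable, and \<open>y powr (p - 1) \<le> 1 + y powr p\<close>.
\<close>

lemma potential_finite:
  assumes h: "h \<in> borel_measurable halfline" and fin: "Cop_norm p \<alpha> h < \<infinity>"
  shows "potential h x < top"
proof (cases "0 < x")
  case False
  then show ?thesis
    by (simp add: potential_def)
next
  case True
  have "potential h x \<le> (\<integral>\<^sup>+\<tau>. ennreal (\<tau> powr \<alpha>) * indicator {0<..<x} \<tau>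
      + epowr (copson h \<tau>) p * ennreal (\<tau> powr \<alpha>) * indicator {0<..} \<tau> \<partial>lebesgue)"
    unfolding potential_def
  proof (intro nn_integral_mono)
    fix \<tau> :: real
    have "epowr y (p - 1) \<le> 1 + epowr y p" for y
    proof (cases y)
      case (real a)
      have "a powr (p - 1) \<le> 1 + a powr p"
      proof (cases "a \<le> 1")
        case True
        then have "a powr (p - 1) \<le> 1 powr (p - 1)"
          using real p by (intro powr_mono2) auto
        then show ?thesis
          by (simp add: add_increasing2)
      next
        case False
        then have "a powr (p - 1) \<le> a powr p"
          by (intro powr_mono) auto
        then show ?thesis
          by simp
      qed
      then show ?thesis
        using real by (simp add: epowr_ennreal flip: ennreal_1 ennreal_plus)
    qed simp
    then have "epowr (copson h \<tau>) (p - 1) * ennreal (\<tau> powr \<alpha>)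
        \<le> (1 + epowr (copson h \<tau>) p) * ennreal (\<tau> powr \<alpha>)"
      by (intro mult_right_mono) auto
    then show "epowr (copson h \<tau>) (p - 1) * ennreal (\<tau> powr \<alpha>) * indicator {0<..<x} \<tau>
        \<le> ennreal (\<tau> powr \<alpha>) * indicator {0<..<x} \<tau>
        + epowr (copson h \<tau>) p * ennreal (\<tau> powr \<alpha>) * indicator {0<..} \<tau>"
      by (auto simp: indicator_def distrib_right)
  qed
  also have "\<dots> = (\<integral>\<^sup>+\<tau>\<in>{0<..<x}. ennreal (\<tau> powr \<alpha>) \<partial>lebesgue)
      + (\<integral>\<^sup>+\<tau>\<in>{0<..}. epowr (copson h \<tau>) p * ennreal (\<tau> powr \<alpha>) \<partial>lebesgue)"
    using borel_measurable_copson[OF h]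
    by (intro nn_integral_add borel_measurable_times_ennreal borel_measurable_indicator
        measurable_epowr) auto
  also have "\<dots> < top"
    using set_nn_integral_powr_from_0[of x "\<alpha> + 1"] True \<alpha> fin by (simp add: Cop_norm_eq)
  finally show ?thesis .
qed

lemma borel_measurable_potential:
  assumes "h \<in> borel_measurable halfline" "Cop_norm p \<alpha> h < \<infinity>"
  shows "(\<lambda>x. enn2real (potential h x)) \<in> borel_measurable (lebesgue_on A)"
proof (rule borel_measurable_lebesgue_on)
  have "mono (\<lambda>x. enn2real (potential h x))"
    using potential_finite[OF assms] by (intro monoI enn2real_mono potential_mono)
  then show "(\<lambda>x. enn2real (potential h x)) \<in> borel_measurable borel"
    by (rule borel_measurable_mono)
qed

lemma copson_eq_0_imp_AE:
  assumes h: "h \<in> borel_measurable halfline" and "copson h t = 0" "0 \<le> t"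
  shows "AE x in lebesgue. t < x \<longrightarrow> h x = 0"
proof -
  have "(\<integral>\<^sup>+x. ennreal (indicator {0<..} x * (\<bar>h x\<bar> / x)) * indicator {t<..} x \<partial>lebesgue) = 0"
    using assms by (simp add: copson_eq_tail)
  then have "AE x in lebesgue. ennreal (indicator {0<..} x * (\<bar>h x\<bar> / x)) * indicator {t<..} x = 0"
    using borel_measurable_copson_density[OF h]
    by (subst (asm) nn_integral_0_iff_AE)
      (auto intro!: borel_measurable_times_ennreal borel_measurable_indicator)
  then show ?thesis
    by eventually_elim (use \<open>0 \<le> t\<close> in \<open>auto simp: indicator_def ennreal_eq_0_iff divide_le_0_iff\<close>)
qed

lemma potential_eq_0_imp_copson:
  assumes "potential h x = 0" "0 < x"
  shows "copson h x = 0"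
proof -
  have "epowr (copson h x) (p - 1) * ennreal (x powr (\<alpha> + 1) / (\<alpha> + 1)) \<le> potential h x"
    unfolding potential_def using assms p by (intro copson_powr_le_integral) auto
  moreover have "0 < x powr (\<alpha> + 1) / (\<alpha> + 1)"
    using assms \<alpha> by simp
  ultimately show ?thesis
    using assms by (auto simp: ennreal_eq_0_iff)
qed

text \<open>
  Where the potential vanishes, the Copson transform vanishes at every smaller positive point,
  and hence \<open>h\<close> vanishes almost everywhere to the right of each such point. Taking these points among the reciprocals of integers keeps the exceptional sets countable in
  number.
\<close>

lemma potential_eq_0_imp_AE:
  assumes h: "h \<in> borel_measurable halfline"
  shows "AE x in lebesgue. 0 < x \<longrightarrow> potential h x = 0 \<longrightarrow> h x = 0"
proof -
  have "AE x in lebesgue. \<forall>n. copson h (inverse (real (Suc n))) = 0 \<longrightarrow> inverse (real (Suc n)) < x \<longrightarrow> h x = 0"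
    unfolding AE_all_countable using copson_eq_0_imp_AE[OF h] by fastforce
  then show ?thesis
  proof eventually_elim
    case (elim x)
    show ?case
    proof (intro impI)
      assume x: "0 < x" "potential h x = 0"
      obtain n where n: "inverse (real (Suc n)) < x"
        using reals_Archimedean x(1) by blast
      have "potential h (inverse (real (Suc n))) \<le> potential h x"
        using n by (intro potential_mono) simp
      with x have "copson h (inverse (real (Suc n))) = 0"
        by (intro potential_eq_0_imp_copson) auto
      with elim n show "h x = 0"
        by blast
    qed
  qed
qed

text \<open>
  The splitting of \<open>\<bar>h\<bar> = \<bar>h\<bar> powr (1 / p) * \<bar>h\<bar> powr (1 / q)\<close> is corrected by reciprocal powers of
  the potential \<open>\<sigma>\<close> and of \<open>x\<close>, chosen such that \<open>\<bar>f\<bar> powr p\<close>, weighted as in \<open>L\<^sup>p\<close>, is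
  \<open>\<sigma> \<bar>h\<bar> / x\<close>, and \<open>\<bar>g\<bar> powr q\<close>, weighted as in \<open>G\<^sup>*\<close>, is
  \<open>\<sigma> powr (- 1 / (p - 1)) \<bar>h\<bar> / x\<close>.
\<close>

definition left_factor :: "(real \<Rightarrow> real) \<Rightarrow> real \<Rightarrow> real" where
  "left_factor h x = sgn (h x) * (\<bar>h x\<bar> * enn2real (potential h x) * x powr (- \<alpha> - 1)) powr (1 / p)"

definition right_factor :: "(real \<Rightarrow> real) \<Rightarrow> real \<Rightarrow> real" where
  "right_factor h x = (\<bar>h x\<bar> * x powr \<gamma> * enn2real (potential h x) powr (- 1 / (p - 1))) powr (1 / q)"

lemma
  assumes h [measurable]: "h \<in> borel_measurable halfline" and fin: "Cop_norm p \<alpha> h < \<infinity>"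
  shows borel_measurable_left_factor: "left_factor h \<in> borel_measurable halfline"
    and borel_measurable_right_factor: "right_factor h \<in> borel_measurable halfline"
proof -
  note borel_measurable_potential[OF h fin, measurable]
  have [measurable]: "(\<lambda>x. sgn (h x)) \<in> borel_measurable halfline"
    unfolding sgn_real_def by measurable
  show "left_factor h \<in> borel_measurable halfline" "right_factor h \<in> borel_measurable halfline"
    unfolding left_factor_def right_factor_def by measurable
qed

lemma factors_mult:
  assumes h: "h \<in> borel_measurable halfline" and fin: "Cop_norm p \<alpha> h < \<infinity>"
  shows "AE x in halfline. h x = left_factor h x * right_factor h x"
proof -
  have "AE x in lebesgue. x \<in> {0<..} \<longrightarrow> h x = left_factor h x * right_factor h x"
    using potential_eq_0_imp_AE[OF h]
  proof eventually_elim
    case (elim x)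
    show ?case
    proof
      assume "x \<in> {0<..}"
      then have x: "0 < x"
        by simp
      define s where "s = enn2real (potential h x)"
      show "h x = left_factor h x * right_factor h x"
      proof (cases "h x = 0")
        case False
        with elim x have "potential h x \<noteq> 0"
          by blast
        moreover have "potential h x < top"
          using potential_finite[OF h fin] .
        ultimately have s: "0 < s"
          by (auto simp: s_def enn2real_positive_iff zero_less_iff_neq_zero)
        have "left_factor h x * right_factor h x
            = sgn (h x) * (\<bar>h x\<bar> powr (1 / p) * \<bar>h x\<bar> powr (1 / q))
              * (s powr (1 / p) * s powr (- 1 / (p - 1) * (1 / q)))
              * (x powr ((- \<alpha> - 1) * (1 / p)) * x powr (\<gamma> * (1 / q)))"
          using s x by (simp add: left_factor_def right_factor_def powr_mult powr_powr flip: s_def)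
        also have "\<bar>h x\<bar> powr (1 / p) * \<bar>h x\<bar> powr (1 / q) = \<bar>h x\<bar>"
          using False conjugate_exponents by (simp flip: powr_add)
        also have "s powr (1 / p) * s powr (- 1 / (p - 1) * (1 / q)) = 1"
        proof -
          have "1 / p + - 1 / (p - 1) * (1 / q) = 0"
            using p by (simp add: q)
          then show ?thesis
            using s by (simp only: powr_add[symmetric]) simp
        qed
        also have "x powr ((- \<alpha> - 1) * (1 / p)) * x powr (\<gamma> * (1 / q)) = 1"
        proof -
          have "\<gamma> * (1 / q) = (\<alpha> + 1) / p"
            using p by (simp add: q \<gamma>_def)
          moreover have "(- \<alpha> - 1) * (1 / p) = - ((\<alpha> + 1) / p)"
            by (simp add: minus_divide_left)
          ultimately have "(- \<alpha> - 1) * (1 / p) + \<gamma> * (1 / q) = 0"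
            by simp
          then show ?thesis
            using x by (simp only: powr_add[symmetric]) simp
        qed
        finally show ?thesis
          by (simp add: sgn_mult_abs)
      qed (simp add: left_factor_def)
    qed
  qed
  then show ?thesis
    by (subst AE_restrict_space_iff) auto
qed

text \<open>
  Interchanging the integrations in \<open>\<integral> \<sigma> \<bar>h\<bar> / x\<close> replaces the integral of \<open>\<bar>h\<bar> / x\<close> over
  \<open>(\<tau>, \<infinity>)\<close> by one more factor \<open>copson h \<tau>\<close>, which completes the power \<open>p - 1\<close> in the potential
  to \<open>p\<close>.
\<close>

lemma Lp_norm_left_factor:
  assumes h: "h \<in> borel_measurable halfline" and fin: "Cop_norm p \<alpha> h < \<infinity>"
  shows "Lp_norm p \<alpha> (left_factor h) = Cop_norm p \<alpha> h"
proof -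
  let ?F = "\<lambda>\<tau>. epowr (copson h \<tau>) (p - 1) * ennreal (\<tau> powr \<alpha>)"
  let ?G = "\<lambda>x. ennreal (indicator {0<..} x * (\<bar>h x\<bar> / x))"
  have "(\<integral>\<^sup>+x\<in>{0<..}. ennreal (\<bar>left_factor h x\<bar> powr p * x powr \<alpha>) \<partial>lebesgue)
      = (\<integral>\<^sup>+x\<in>{0<..}. ?G x * potential h x \<partial>lebesgue)"
  proof (intro nn_integral_cong)
    fix x :: real
    have "ennreal (\<bar>left_factor h x\<bar> powr p * x powr \<alpha>) = ennreal (\<bar>h x\<bar> / x) * potential h x" if x: "0 < x"
    proof -
      define s where "s = enn2real (potential h x)"
      have s: "0 \<le> s" "potential h x = ennreal s"
        using potential_finite[OF h fin, of x] by (auto simp: s_def)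
      have "\<bar>left_factor h x\<bar> powr p = \<bar>h x\<bar> * s * x powr (- \<alpha> - 1)"
        using p s x by (simp add: left_factor_def abs_mult abs_sgn_eq powr_mult powr_powr flip: s_def)
      also have "\<dots> * x powr \<alpha> = \<bar>h x\<bar> * s * (x powr (- \<alpha> - 1) * x powr \<alpha>)"
        by simp
      also have "x powr (- \<alpha> - 1) * x powr \<alpha> = 1 / x"
        using x by (simp add: powr_minus_divide flip: powr_add)
      finally show ?thesis
        using s x by (simp flip: ennreal_mult)
    qed
    then show "ennreal (\<bar>left_factor h x\<bar> powr p * x powr \<alpha>) * indicator {0<..} x
        = ?G x * potential h x * indicator {0<..} x"
      by (auto simp: indicator_def)
  qed
  also have "\<dots> = (\<integral>\<^sup>+\<tau>\<in>{0<..}. ?F \<tau> * (\<integral>\<^sup>+x\<in>{\<tau><..}. ?G x \<partial>lebesgue) \<partial>lebesgue)"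
    unfolding potential_def
    using borel_measurable_copson[OF h] borel_measurable_copson_density[OF h]
    by (intro set_nn_integral_swap_triangle[symmetric] borel_measurable_times_ennreal measurable_epowr) auto
  also have "\<dots> = (\<integral>\<^sup>+\<tau>\<in>{0<..}. epowr (copson h \<tau>) p * ennreal (\<tau> powr \<alpha>) \<partial>lebesgue)"
  proof (intro nn_integral_cong)
    fix \<tau> :: real
    have "epowr (copson h \<tau>) p = epowr (copson h \<tau>) (p - 1) * copson h \<tau>"
      using epowr_add[of "copson h \<tau>" "p - 1" 1] by simp
    then show "?F \<tau> * (\<integral>\<^sup>+x\<in>{\<tau><..}. ?G x \<partial>lebesgue) * indicator {0<..} \<tau>
        = epowr (copson h \<tau>) p * ennreal (\<tau> powr \<alpha>) * indicator {0<..} \<tau>"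
      by (subst copson_eq_tail[symmetric]) (simp add: mult_ac)
  qed
  finally show ?thesis
    by (simp add: Lp_norm_def Cop_norm_eq)
qed

text \<open>
  Since the potential \<open>\<sigma>\<close> increases, the weighted tail of \<open>\<bar>g\<bar> powr q\<close> at \<open>t\<close> is at most
  \<open>\<sigma> t powr (- 1 / (p - 1)) * copson h t\<close>. Since \<open>\<sigma>\<close> dominates
  \<open>copson h t powr (p - 1) * t powr (\<alpha> + 1) / (\<alpha> + 1)\<close>, the transform cancels and only
  a constant times \<open>t powr - \<gamma>\<close> remains, whatever \<open>h\<close> is.
\<close>

lemma Gstar_norm_right_factor_le:
  assumes h: "h \<in> borel_measurable halfline" and fin: "Cop_norm p \<alpha> h < \<infinity>"
  shows "Gstar_norm q (\<alpha> * (1 - q)) (right_factor h) \<le> ennreal ((\<alpha> + 1) / (p - 1) powr (1 / q))"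
proof (subst Gstar_norm_le_iff; (intro allI impI)?)
  show "0 \<le> (\<alpha> + 1) / (p - 1) powr (1 / q)"
    using \<alpha> by simp
next
  fix t :: real assume t: "0 < t"
  let ?s = "\<lambda>x. enn2real (potential h x)"
  have "((\<alpha> + 1) / (p - 1) powr (1 / q)) powr q = (\<alpha> + 1) powr q / (p - 1)"
    using p \<alpha> q_gt_1 by (simp add: powr_divide powr_powr)
  also have "(\<alpha> + 1) powr q = (\<alpha> + 1) powr (1 / (p - 1)) * (\<alpha> + 1)"
  proof -
    have "q = 1 / (p - 1) + 1"
      using p by (simp add: q field_simps)
    then show ?thesis
      using \<alpha> by (simp add: powr_add)
  qed
  finally have const: "((\<alpha> + 1) / (p - 1) powr (1 / q)) powr q / \<gamma> = (\<alpha> + 1) powr (1 / (p - 1))"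
    using p \<alpha> by (simp add: \<gamma>_def)
  obtain \<eta> where \<eta>: "copson h t = ennreal \<eta>" "0 \<le> \<eta>"
    using copson_finite[OF fin t] by (cases "copson h t") auto
  have s: "potential h x = ennreal (?s x)" for x
    using potential_finite[OF h fin, of x] by simp
  have le: "\<eta> powr (p - 1) * (t powr (\<alpha> + 1) / (\<alpha> + 1)) \<le> ?s t"
  proof -
    have "epowr (copson h t) (p - 1) * ennreal (t powr (\<alpha> + 1) / (\<alpha> + 1)) \<le> potential h t"
      unfolding potential_def using t p by (intro copson_powr_le_integral) auto
    then show ?thesis
      using \<eta> \<alpha> by (subst (asm) s) (simp add: epowr_ennreal flip: ennreal_mult)
  qed
  have "(\<integral>\<^sup>+x\<in>{t<..}. ennreal (\<bar>right_factor h x\<bar> powr q * x powr (- \<gamma> - 1)) \<partial>lebesgue)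
      = (\<integral>\<^sup>+x\<in>{t<..}. ennreal (\<bar>h x\<bar> / x * ?s x powr (- 1 / (p - 1))) \<partial>lebesgue)"
  proof (intro nn_integral_cong)
    fix x :: real
    have "\<bar>right_factor h x\<bar> powr q * x powr (- \<gamma> - 1) = \<bar>h x\<bar> / x * ?s x powr (- 1 / (p - 1))" if "0 < x"
    proof -
      have "\<bar>right_factor h x\<bar> powr q * x powr (- \<gamma> - 1)
          = \<bar>h x\<bar> * ?s x powr (- 1 / (p - 1)) * (x powr \<gamma> * x powr (- \<gamma> - 1))"
        using q_gt_1 by (simp add: right_factor_def powr_powr)
      also have "x powr \<gamma> * x powr (- \<gamma> - 1) = 1 / x"
        using that by (simp add: powr_minus_divide flip: powr_add)
      finally show ?thesis
        by simp
    qed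
    then show "ennreal (\<bar>right_factor h x\<bar> powr q * x powr (- \<gamma> - 1)) * indicator {t<..} x
        = ennreal (\<bar>h x\<bar> / x * ?s x powr (- 1 / (p - 1))) * indicator {t<..} x"
      using t by (simp add: indicator_def)
  qed
  also have "\<dots> \<le> ennreal ((\<alpha> + 1) powr (1 / (p - 1)) * t powr - \<gamma>)"
  \<comment> \<open>If \<open>\<sigma> t = 0\<close>, the bound by monotonicity is void because \<open>0 powr r = 0\<close> for negative \<open>r\<close> too.\<close>
  proof (cases "?s t = 0")
    case True
    then have "copson h t = 0"
      using s[of t] t by (intro potential_eq_0_imp_copson) auto
    then have "AE x in lebesgue. t < x \<longrightarrow> h x = 0"
      using h t by (intro copson_eq_0_imp_AE) auto
    then have "AE x in lebesgue. ennreal (\<bar>h x\<bar> / x * ?s x powr (- 1 / (p - 1))) * indicator {t<..} x = 0"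
      by eventually_elim (auto simp: indicator_def)
    then have "(\<integral>\<^sup>+x\<in>{t<..}. ennreal (\<bar>h x\<bar> / x * ?s x powr (- 1 / (p - 1))) \<partial>lebesgue) = (\<integral>\<^sup>+x. 0 \<partial>(lebesgue :: real measure))"
      by (rule nn_integral_cong_AE)
    then show ?thesis
      by simp
  next
    case False
    then have st: "0 < ?s t"
      by (simp add: less_le)
    have "(\<integral>\<^sup>+x\<in>{t<..}. ennreal (\<bar>h x\<bar> / x * ?s x powr (- 1 / (p - 1))) \<partial>lebesgue)
        \<le> (\<integral>\<^sup>+x. ennreal (?s t powr (- 1 / (p - 1))) * (ennreal (indicator {0<..} x * (\<bar>h x\<bar> / x)) * indicator {t<..} x) \<partial>lebesgue)"
    proof (intro nn_integral_mono)
      fix x :: real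
      have "?s x powr (- 1 / (p - 1)) \<le> ?s t powr (- 1 / (p - 1))" if "t < x"
      proof -
        have "?s t \<le> ?s x"
          using that potential_finite[OF h fin] by (intro enn2real_mono potential_mono) auto
        then show ?thesis
          using st p by (intro powr_mono2') auto
      qed
      then have "\<bar>h x\<bar> / x * ?s x powr (- 1 / (p - 1)) \<le> ?s t powr (- 1 / (p - 1)) * (\<bar>h x\<bar> / x)" if "t < x"
        using that t by (subst mult.commute) (intro mult_right_mono, auto)
      then show "ennreal (\<bar>h x\<bar> / x * ?s x powr (- 1 / (p - 1))) * indicator {t<..} x
          \<le> ennreal (?s t powr (- 1 / (p - 1))) * (ennreal (indicator {0<..} x * (\<bar>h x\<bar> / x)) * indicator {t<..} x)"
        using t by (auto simp: indicator_def ennreal_leI simp flip: ennreal_mult)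
    qed
    also have "\<dots> = ennreal (?s t powr (- 1 / (p - 1))) * copson h t"
      unfolding copson_eq_tail using borel_measurable_copson_density[OF h]
      by (intro nn_integral_cmult borel_measurable_times_ennreal borel_measurable_indicator) auto
    also have "\<dots> = ennreal (?s t powr (- 1 / (p - 1)) * \<eta>)"
      using \<eta> by (simp add: ennreal_mult)
    also have "?s t powr (- 1 / (p - 1)) * \<eta> \<le> (\<alpha> + 1) powr (1 / (p - 1)) * t powr - \<gamma>"
    proof -
      have "(\<eta> powr (p - 1) * (t powr (\<alpha> + 1) / (\<alpha> + 1))) powr (1 / (p - 1)) \<le> ?s t powr (1 / (p - 1))"
        using le p \<eta> \<alpha> by (intro powr_mono2) auto
      also have "(\<eta> powr (p - 1) * (t powr (\<alpha> + 1) / (\<alpha> + 1))) powr (1 / (p - 1))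
          = \<eta> * (t powr \<gamma> / (\<alpha> + 1) powr (1 / (p - 1)))"
        using p \<eta> \<alpha> t by (simp add: powr_mult powr_divide powr_powr \<gamma>_def)
      finally show ?thesis
        using st t \<alpha> by (simp add: powr_minus field_simps)
    qed
    finally show ?thesis
      by (simp add: ennreal_leI)
  qed
  finally show "(\<integral>\<^sup>+x\<in>{t<..}. ennreal (\<bar>right_factor h x\<bar> powr q * x powr (- \<gamma> - 1)) \<partial>lebesgue)
      \<le> ennreal (((\<alpha> + 1) / (p - 1) powr (1 / q)) powr q / \<gamma> * t powr - \<gamma>)"
    by (simp only: const)
qed

section \<open>Membership and the two inequalities\<close>

lemma is_factorization_factors:
  assumes "h \<in> Cop p \<alpha>"
  shows "is_factorization p q \<alpha> h (left_factor h) (right_factor h)"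
proof -
  have h: "h \<in> borel_measurable halfline" "Cop_norm p \<alpha> h < \<infinity>"
    using assms by (auto simp: Cop_def)
  have "Gstar_norm q (\<alpha> * (1 - q)) (right_factor h) < \<infinity>"
    using Gstar_norm_right_factor_le[OF h] by (auto intro: le_less_trans)
  then show ?thesis
    using h by (auto simp: is_factorization_def Lp_def Gstar_def Lp_norm_left_factor
        borel_measurable_left_factor borel_measurable_right_factor factors_mult)
qed

lemma is_factorizationE:
  assumes "is_factorization p q \<alpha> h f g"
  obtains k l where "f \<in> borel_measurable halfline" "g \<in> borel_measurable halfline"
    "AE x in halfline. h x = f x * g x"
    "0 \<le> l" "Lp_norm p \<alpha> f = ennreal l" "0 \<le> k" "Gstar_norm q (\<alpha> * (1 - q)) g = ennreal k"
proof -
  have *: "f \<in> borel_measurable halfline" "g \<in> borel_measurable halfline"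
    "AE x in halfline. h x = f x * g x" "Lp_norm p \<alpha> f < top" "Gstar_norm q (\<alpha> * (1 - q)) g < top"
    using assms by (auto simp: is_factorization_def Lp_def Gstar_def)
  then show ?thesis
    by (cases "Lp_norm p \<alpha> f"; cases "Gstar_norm q (\<alpha> * (1 - q)) g") (auto intro: that)
qed

lemma Cop_norm_le_factors:
  assumes "is_factorization p q \<alpha> h f g"
  shows "Cop_norm p \<alpha> h \<le> ennreal (p / (\<alpha> + 1)) * (Lp_norm p \<alpha> f * Gstar_norm q (\<alpha> * (1 - q)) g)"
proof -
  obtain k where "f \<in> borel_measurable halfline" "g \<in> borel_measurable halfline"
      "AE x in halfline. h x = f x * g x" "0 \<le> k" "Gstar_norm q (\<alpha> * (1 - q)) g = ennreal k"
    using assms by (elim is_factorizationE)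
  then show ?thesis
    using Cop_norm_mult_le[of f g h k] by simp
qed

lemma Cop_norm_finite_of_factorization:
  assumes "is_factorization p q \<alpha> h f g"
  shows "Cop_norm p \<alpha> h < \<infinity>"
proof -
  obtain k l where "Lp_norm p \<alpha> f = ennreal l" "Gstar_norm q (\<alpha> * (1 - q)) g = ennreal k"
    using assms by (elim is_factorizationE)
  then have "ennreal (p / (\<alpha> + 1)) * (Lp_norm p \<alpha> f * Gstar_norm q (\<alpha> * (1 - q)) g) < \<infinity>"
    by (simp add: ennreal_mult_less_top)
  with Cop_norm_le_factors[OF assms] show ?thesis
    by (rule le_less_trans)
qed

lemma Cop_iff_factorization:
  assumes "h \<in> borel_measurable halfline"
  shows "h \<in> Cop p \<alpha> \<longleftrightarrow> (\<exists>f g. is_factorization p q \<alpha> h f g)"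
  using assms is_factorization_factors Cop_norm_finite_of_factorization by (auto simp: Cop_def)

lemma Cop_norm_le_Nstar:
  assumes "h \<in> Cop p \<alpha>"
  shows "Cop_norm p \<alpha> h \<le> ennreal (p / (\<alpha> + 1)) * Nstar p q \<alpha> h"
proof -
  define c where "c = p / (\<alpha> + 1)"
  have c: "0 < c"
    using p \<alpha> by (simp add: c_def)
  have cancel: "ennreal (1 / c) * (ennreal c * y) = y" for y
    using c by (simp add: mult.assoc[symmetric] flip: ennreal_mult)
  have "ennreal (1 / c) * Cop_norm p \<alpha> h \<le> Nstar p q \<alpha> h"
    unfolding Nstar_def
  proof (safe intro!: INF_greatest)
    fix f g assume "is_factorization p q \<alpha> h f g"
    then have "ennreal (1 / c) * Cop_norm p \<alpha> h
        \<le> ennreal (1 / c) * (ennreal c * (Lp_norm p \<alpha> f * Gstar_norm q (\<alpha> * (1 - q)) g))"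
      unfolding c_def by (intro mult_left_mono Cop_norm_le_factors) auto
    then show "ennreal (1 / c) * Cop_norm p \<alpha> h \<le> Lp_norm p \<alpha> f * Gstar_norm q (\<alpha> * (1 - q)) g"
      by (simp only: cancel)
  qed
  then have "ennreal c * (ennreal (1 / c) * Cop_norm p \<alpha> h) \<le> ennreal c * Nstar p q \<alpha> h"
    by (intro mult_left_mono) auto
  moreover have "ennreal c * ennreal (1 / c) = 1"
    using c by (simp flip: ennreal_mult)
  ultimately show ?thesis
    by (simp add: c_def[symmetric] mult.assoc[symmetric])
qed

lemma Nstar_le_Cop_norm:
  assumes "h \<in> Cop p \<alpha>"
  shows "ennreal ((p - 1) powr (1 / q) / (\<alpha> + 1)) * Nstar p q \<alpha> h \<le> Cop_norm p \<alpha> h"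
proof -
  have h: "h \<in> borel_measurable halfline" "Cop_norm p \<alpha> h < \<infinity>"
    using assms by (auto simp: Cop_def)
  have "Nstar p q \<alpha> h
      \<le> Lp_norm p \<alpha> (left_factor h) * Gstar_norm q (\<alpha> * (1 - q)) (right_factor h)"
    unfolding Nstar_def
    by (rule INF_lower2[of "(left_factor h, right_factor h)"])
      (use is_factorization_factors[OF assms] in auto)
  also have "\<dots> \<le> Cop_norm p \<alpha> h * ennreal ((\<alpha> + 1) / (p - 1) powr (1 / q))"
    using Gstar_norm_right_factor_le[OF h] by (simp add: Lp_norm_left_factor[OF h] mult_left_mono)
  finally have "ennreal ((p - 1) powr (1 / q) / (\<alpha> + 1)) * Nstar p q \<alpha> h
      \<le> ennreal ((p - 1) powr (1 / q) / (\<alpha> + 1))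
        * (Cop_norm p \<alpha> h * ennreal ((\<alpha> + 1) / (p - 1) powr (1 / q)))"
    by (rule mult_left_mono) simp
  also have "\<dots> = Cop_norm p \<alpha> h
      * (ennreal ((p - 1) powr (1 / q) / (\<alpha> + 1)) * ennreal ((\<alpha> + 1) / (p - 1) powr (1 / q)))"
    by (simp add: mult_ac)
  also have "\<dots> = Cop_norm p \<alpha> h"
    using p \<alpha> by (simp flip: ennreal_mult)
  finally show ?thesis .
qed

section \<open>Optimality of the lower constant\<close>

text \<open>
  A lower bound for every factorization norm, by Hoelder's inequality on \<open>(1, \<infinity>)\<close> with the weights
  of the two norms. It is nearly attained when \<open>h\<close> lives close to the point \<open>1\<close>.
\<close>

lemma copson_one_le_Nstar: "ennreal (\<gamma> powr (1 / q)) * copson h 1 \<le> Nstar p q \<alpha> h"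
  unfolding Nstar_def
proof (safe intro!: INF_greatest)
  fix f g assume "is_factorization p q \<alpha> h f g"
  then obtain k l where fg: "f \<in> borel_measurable halfline" "g \<in> borel_measurable halfline"
      "AE x in halfline. h x = f x * g x"
    and k: "0 \<le> k" "Gstar_norm q (\<alpha> * (1 - q)) g = ennreal k"
    by (elim is_factorizationE)
  have exponent: "- \<gamma> - 1 = - (p + \<alpha>) / (p - 1)"
  proof -
    have "(p + \<alpha>) / (p - 1) = (\<alpha> + 1) / (p - 1) + (p - 1) / (p - 1)"
      by (simp only: add_divide_distrib[symmetric]) simp
    then show ?thesis
      using p by (simp only: minus_divide_left[symmetric]) (simp add: \<gamma>_def)
  qed
  let ?J = "\<integral>\<^sup>+x\<in>{0<..}. ennreal (\<bar>f x\<bar> powr p * x powr \<alpha>) \<partial>lebesgue"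
  have "epowr (copson h 1) p \<le> (\<integral>\<^sup>+x\<in>{1<..}. ennreal (\<bar>f x\<bar> powr p * x powr \<alpha>) \<partial>lebesgue)
      * epowr (\<integral>\<^sup>+x\<in>{1<..}. ennreal (\<bar>g x\<bar> powr q * x powr (- \<gamma> - 1)) \<partial>lebesgue) (p - 1)"
    by (rule copson_mult_Holder[OF fg _ exponent]) simp
  also have "\<dots> \<le> ?J * epowr (ennreal (k powr q / \<gamma>)) (p - 1)"
  proof (intro mult_mono epowr_mono)
    show "(\<integral>\<^sup>+x\<in>{1<..}. ennreal (\<bar>f x\<bar> powr p * x powr \<alpha>) \<partial>lebesgue) \<le> ?J"
      by (intro nn_integral_mono) (auto simp: indicator_def)
    have "Gstar_norm q (\<alpha> * (1 - q)) g \<le> ennreal k"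
      using k by simp
    then show "(\<integral>\<^sup>+x\<in>{1<..}. ennreal (\<bar>g x\<bar> powr q * x powr (- \<gamma> - 1)) \<partial>lebesgue) \<le> ennreal (k powr q / \<gamma>)"
      using k(1) by (subst (asm) Gstar_norm_le_iff) (auto dest: spec[of _ 1])
  qed (use p in auto)
  finally have "epowr (epowr (copson h 1) p) (1 / p)
      \<le> epowr (?J * epowr (ennreal (k powr q / \<gamma>)) (p - 1)) (1 / p)"
    using p by (intro epowr_mono) auto
  then have "copson h 1 \<le> Lp_norm p \<alpha> f * epowr (ennreal (k powr q / \<gamma>)) ((p - 1) * (1 / p))"
    using p by (simp add: epowr_epowr epowr_mult Lp_norm_def)
  also have "(p - 1) * (1 / p) = 1 / q"
    using p by (simp add: q)
  also have "epowr (ennreal (k powr q / \<gamma>)) (1 / q) = ennreal (k / \<gamma> powr (1 / q))"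
    using k \<gamma>_pos q_gt_1 by (simp add: epowr_ennreal powr_divide powr_powr)
  finally have "ennreal (\<gamma> powr (1 / q)) * copson h 1
      \<le> ennreal (\<gamma> powr (1 / q)) * (Lp_norm p \<alpha> f * ennreal (k / \<gamma> powr (1 / q)))"
    by (rule mult_left_mono) simp
  also have "\<dots> = Lp_norm p \<alpha> f * (ennreal (\<gamma> powr (1 / q)) * ennreal (k / \<gamma> powr (1 / q)))"
    by (simp add: mult_ac)
  also have "\<dots> = Lp_norm p \<alpha> f * Gstar_norm q (\<alpha> * (1 - q)) g"
    using k \<gamma>_pos by (simp flip: ennreal_mult)
  finally show "ennreal (\<gamma> powr (1 / q)) * copson h 1 \<le> Lp_norm p \<alpha> f * Gstar_norm q (\<alpha> * (1 - q)) g" .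
qed

text \<open>
  The factor \<open>x\<close> cancels the density of the measure \<open>dx / x\<close>, so that the Copson transform of the
  bump is the length of an interval.
\<close>

definition bump :: "real \<Rightarrow> real \<Rightarrow> real" where
  "bump \<epsilon> x = x * indicator {1<..1 + \<epsilon>} x"

lemma borel_measurable_bump: "bump \<epsilon> \<in> borel_measurable halfline"
  unfolding bump_def by (rule borel_measurable_lebesgue_on) measurable

lemma
  assumes "0 < \<epsilon>" "0 < t"
  shows copson_bump_le: "copson (bump \<epsilon>) t \<le> ennreal \<epsilon> * indicator {..<1 + \<epsilon>} t"
    and copson_bump_one: "copson (bump \<epsilon>) 1 = ennreal \<epsilon>"
proof -
  have eq: "copson (bump \<epsilon>) t = emeasure lebesgue ({t<..} \<inter> {1<..1 + \<epsilon>})" if "0 < t" for t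
  proof -
    have "copson (bump \<epsilon>) t = (\<integral>\<^sup>+x. indicator ({t<..} \<inter> {1<..1 + \<epsilon>}) x \<partial>lebesgue)"
      unfolding copson_def by (intro nn_integral_cong) (auto simp: bump_def indicator_def)
    then show ?thesis
      by simp
  qed
  have "{1<..} \<inter> {1<..1 + \<epsilon>} = {1<..1 + \<epsilon>}"
    by auto
  then show "copson (bump \<epsilon>) 1 = ennreal \<epsilon>"
    using assms by (simp add: eq)
  show "copson (bump \<epsilon>) t \<le> ennreal \<epsilon> * indicator {..<1 + \<epsilon>} t"
  proof (cases "t < 1 + \<epsilon>")
    case True
    have "copson (bump \<epsilon>) t \<le> emeasure lebesgue {1<..1 + \<epsilon>}"
      unfolding eq[OF \<open>0 < t\<close>] by (intro emeasure_mono) auto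
    then show ?thesis
      using True assms by simp
  next
    case False
    then have "{t<..} \<inter> {1<..1 + \<epsilon>} = {}"
      by auto
    then show ?thesis
      by (simp add: eq[OF \<open>0 < t\<close>])
  qed
qed

lemma Cop_norm_bump_le:
  assumes \<epsilon>: "0 < \<epsilon>"
  shows "Cop_norm p \<alpha> (bump \<epsilon>) \<le> ennreal (\<epsilon> * ((1 + \<epsilon>) powr \<delta> / (\<alpha> + 1) powr (1 / p)))"
proof -
  have "(\<integral>\<^sup>+t\<in>{0<..}. epowr (copson (bump \<epsilon>) t) p * ennreal (t powr \<alpha>) \<partial>lebesgue)
      \<le> (\<integral>\<^sup>+t. ennreal (\<epsilon> powr p) * (ennreal (t powr \<alpha>) * indicator {0<..<1 + \<epsilon>} t) \<partial>lebesgue)"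
  proof (intro nn_integral_mono)
    fix t :: real
    show "epowr (copson (bump \<epsilon>) t) p * ennreal (t powr \<alpha>) * indicator {0<..} t
        \<le> ennreal (\<epsilon> powr p) * (ennreal (t powr \<alpha>) * indicator {0<..<1 + \<epsilon>} t)"
    proof (cases "0 < t")
      case True
      then have "epowr (copson (bump \<epsilon>) t) p \<le> epowr (ennreal \<epsilon> * indicator {..<1 + \<epsilon>} t) p"
        using \<epsilon> p by (intro epowr_mono copson_bump_le) auto
      also have "\<dots> = ennreal (\<epsilon> powr p) * indicator {..<1 + \<epsilon>} t"
        using \<epsilon> by (simp add: indicator_def epowr_ennreal)
      finally have "epowr (copson (bump \<epsilon>) t) p * ennreal (t powr \<alpha>)
          \<le> ennreal (\<epsilon> powr p) * indicator {..<1 + \<epsilon>} t * ennreal (t powr \<alpha>)"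
        by (rule mult_right_mono) simp
      then show ?thesis
        using True by (auto simp: indicator_def)
    qed simp
  qed
  also have "\<dots> = ennreal (\<epsilon> powr p) * (\<integral>\<^sup>+t\<in>{0<..<1 + \<epsilon>}. ennreal (t powr \<alpha>) \<partial>lebesgue)"
    by (intro nn_integral_cmult borel_measurable_times_ennreal borel_measurable_indicator) auto
  also have "\<dots> = ennreal (\<epsilon> powr p * ((1 + \<epsilon>) powr (\<alpha> + 1) / (\<alpha> + 1)))"
    using set_nn_integral_powr_from_0[of "1 + \<epsilon>" "\<alpha> + 1"] \<epsilon> \<alpha> by (simp flip: ennreal_mult)
  finally have "Cop_norm p \<alpha> (bump \<epsilon>) \<le> epowr (ennreal (\<epsilon> powr p * ((1 + \<epsilon>) powr (\<alpha> + 1) / (\<alpha> + 1)))) (1 / p)"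
    unfolding Cop_norm_eq using p by (intro epowr_mono) auto
  also have "\<dots> = ennreal (\<epsilon> * ((1 + \<epsilon>) powr \<delta> / (\<alpha> + 1) powr (1 / p)))"
    using \<epsilon> p \<alpha> by (simp add: epowr_ennreal powr_mult powr_divide powr_powr \<delta>_def)
  finally show ?thesis .
qed

text \<open>
  Divided by \<open>\<epsilon>\<close>, the Copson transform of the bump tends to the indicator of \<open>(0, 1)\<close> as \<open>\<epsilon>\<close> tends
  to \<open>0\<close>; in this limit \<open>copson_one_le_Nstar\<close> and the computation of the norm leave no gap.
\<close>

lemma lower_constant_optimal:
  fixes c :: real
  assumes "\<And>h. h \<in> Cop p \<alpha> \<Longrightarrow> ennreal c * Nstar p q \<alpha> h \<le> Cop_norm p \<alpha> h"
  shows "c \<le> (p - 1) powr (1 / q) / (\<alpha> + 1)"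
proof -
  define c\<^sub>0 where "c\<^sub>0 = (p - 1) powr (1 / q) / (\<alpha> + 1)"
  have c0: "c\<^sub>0 * (\<gamma> powr (1 / q) * (\<alpha> + 1) powr (1 / p)) = 1"
  proof -
    have "(\<alpha> + 1) powr (1 / q) * (\<alpha> + 1) powr (1 / p) = \<alpha> + 1"
      using \<alpha> conjugate_exponents by (simp add: add.commute flip: powr_add)
    then show ?thesis
      using p \<alpha> by (simp add: c\<^sub>0_def \<gamma>_def powr_divide)
  qed
  have bound: "c \<le> c\<^sub>0 * (1 + \<epsilon>) powr \<delta>" if \<epsilon>: "0 < \<epsilon>" for \<epsilon>
  proof (cases "0 \<le> c")
    case True
    have "Cop_norm p \<alpha> (bump \<epsilon>) < \<infinity>"
      using Cop_norm_bump_le[OF \<epsilon>] by (rule le_less_trans) simp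
    then have "bump \<epsilon> \<in> Cop p \<alpha>"
      by (simp add: Cop_def borel_measurable_bump)
    have "ennreal (c * (\<gamma> powr (1 / q) * \<epsilon>)) = ennreal c * (ennreal (\<gamma> powr (1 / q)) * copson (bump \<epsilon>) 1)"
      using True \<epsilon> by (simp add: copson_bump_one[OF \<epsilon> \<epsilon>] ennreal_mult)
    also have "\<dots> \<le> ennreal c * Nstar p q \<alpha> (bump \<epsilon>)"
      by (intro mult_left_mono copson_one_le_Nstar) simp
    also have "\<dots> \<le> Cop_norm p \<alpha> (bump \<epsilon>)"
      by (rule assms) fact
    also have "\<dots> \<le> ennreal (\<epsilon> * ((1 + \<epsilon>) powr \<delta> / (\<alpha> + 1) powr (1 / p)))"
      using \<epsilon> by (rule Cop_norm_bump_le)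
    finally have "c * (\<gamma> powr (1 / q) * \<epsilon>) \<le> \<epsilon> * ((1 + \<epsilon>) powr \<delta> / (\<alpha> + 1) powr (1 / p))"
      using \<epsilon> by simp
    then have "c * (\<gamma> powr (1 / q) * (\<alpha> + 1) powr (1 / p)) \<le> (1 + \<epsilon>) powr \<delta>"
      using \<epsilon> \<alpha> by (simp add: field_simps)
    then have "c\<^sub>0 * (c * (\<gamma> powr (1 / q) * (\<alpha> + 1) powr (1 / p))) \<le> c\<^sub>0 * (1 + \<epsilon>) powr \<delta>"
      using \<alpha> by (intro mult_left_mono) (auto simp: c\<^sub>0_def)
    then show ?thesis
      using c0 by (simp add: mult.left_commute[of c\<^sub>0])
  next
    case False
    have "0 \<le> c\<^sub>0 * (1 + \<epsilon>) powr \<delta>"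
      using \<alpha> by (simp add: c\<^sub>0_def)
    with False show ?thesis
      by simp
  qed
  have "((\<lambda>\<epsilon>. c\<^sub>0 * (1 + \<epsilon>) powr \<delta>) \<longlongrightarrow> c\<^sub>0 * (1 + 0) powr \<delta>) (at_right 0)"
    by (intro tendsto_intros) auto
  moreover have "\<forall>\<^sub>F \<epsilon> in at_right 0. c \<le> c\<^sub>0 * (1 + \<epsilon>) powr \<delta>"
    using bound by (auto simp: eventually_at_right_field intro: exI[of _ 1])
  ultimately have "c \<le> c\<^sub>0 * (1 + 0) powr \<delta>"
    by (rule tendsto_lowerbound) simp
  then show ?thesis
    by (simp add: c\<^sub>0_def)
qed

section \<open>Optimality of the upper constant\<close>

lemma Gstar_norm_one_le: "Gstar_norm q (\<alpha> * (1 - q)) (\<lambda>_. 1) \<le> 1"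
proof -
  have "Gstar_norm q (\<alpha> * (1 - q)) (\<lambda>_. 1) \<le> ennreal 1"
    by (subst Gstar_norm_le_iff) (auto simp: set_nn_integral_powr_tail \<gamma>_pos)
  then show ?thesis
    by simp
qed

text \<open>
  Extremal up to a limit in the Hardy inequality: to the right of \<open>1\<close> the Copson transform
  multiplies this function by exactly \<open>1 / a\<close>, and \<open>a\<close> may approach \<open>\<delta>\<close>, where the function leaves
  \<open>L\<^sup>p\<close>.
\<close>

definition power_tail :: "real \<Rightarrow> real \<Rightarrow> real" where
  "power_tail a x = x powr - a * indicator {1<..} x"

lemma power_tail_norms:
  assumes a: "\<delta> < a"
  defines "l \<equiv> (1 / (p * (a - \<delta>))) powr (1 / p)"
  shows "Lp_norm p \<alpha> (power_tail a) = ennreal l"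
    and "ennreal (l / a) \<le> Cop_norm p \<alpha> (power_tail a)"
proof -
  have a0: "0 < a"
    using a \<delta>_pos by simp
  define r where "r = p * (a - \<delta>)"
  have r: "0 < r"
    using a p by (simp add: r_def)
  have exponent: "- a * p + \<alpha> = - r - 1"
    using p by (simp add: r_def \<delta>_def field_simps)
  have weight: "(x powr - a) powr p * x powr \<alpha> = x powr (- r - 1)" for x :: real
    using exponent by (simp add: powr_powr flip: powr_add)
  have tail: "(\<integral>\<^sup>+x\<in>{1<..}. ennreal (x powr (- r - 1)) \<partial>lebesgue) = ennreal (1 / r)"
    using set_nn_integral_powr_tail[of 1 r] r by simp
  have "(\<integral>\<^sup>+x\<in>{0<..}. ennreal (\<bar>power_tail a x\<bar> powr p * x powr \<alpha>) \<partial>lebesgue)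
      = (\<integral>\<^sup>+x\<in>{1<..}. ennreal (x powr (- r - 1)) \<partial>lebesgue)"
    by (intro nn_integral_cong) (auto simp: power_tail_def indicator_def weight)
  then show "Lp_norm p \<alpha> (power_tail a) = ennreal l"
    using r by (simp add: Lp_norm_def tail epowr_ennreal l_def flip: r_def)
  have copson: "copson (power_tail a) t = ennreal (t powr - a / a)" if "1 < t" for t
  proof -
    have "copson (power_tail a) t = (\<integral>\<^sup>+x\<in>{t<..}. ennreal (x powr (- a - 1)) \<partial>lebesgue)"
      unfolding copson_def
    proof (intro nn_integral_cong)
      fix x :: real
      have "x powr (- a - 1) = x powr - a / x" if "0 < x"
        using that by (simp add: powr_diff)
      then show "ennreal (\<bar>power_tail a x\<bar> / x) * indicator {t<..} x
          = ennreal (x powr (- a - 1)) * indicator {t<..} x"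
        using \<open>1 < t\<close> by (simp add: power_tail_def indicator_def)
    qed
    then show ?thesis
      using that a0 by (simp add: set_nn_integral_powr_tail)
  qed
  have "ennreal (1 / a powr p * (1 / r))
      = ennreal (1 / a powr p) * (\<integral>\<^sup>+x\<in>{1<..}. ennreal (x powr (- r - 1)) \<partial>lebesgue)"
    using r by (simp add: tail flip: ennreal_mult)
  also have "\<dots> = (\<integral>\<^sup>+t. ennreal (1 / a powr p) * (ennreal (t powr (- r - 1)) * indicator {1<..} t) \<partial>lebesgue)"
    by (intro nn_integral_cmult[symmetric] borel_measurable_times_ennreal borel_measurable_indicator) auto
  also have "\<dots> \<le> (\<integral>\<^sup>+t\<in>{0<..}. epowr (copson (power_tail a) t) p * ennreal (t powr \<alpha>) \<partial>lebesgue)"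
  proof (intro nn_integral_mono)
    fix t :: real
    have "epowr (copson (power_tail a) t) p * ennreal (t powr \<alpha>)
        = ennreal (1 / a powr p) * ennreal (t powr (- r - 1))" if "1 < t"
      using that a0 by (simp add: copson epowr_ennreal powr_divide weight flip: ennreal_mult)
    then show "ennreal (1 / a powr p) * (ennreal (t powr (- r - 1)) * indicator {1<..} t)
        \<le> epowr (copson (power_tail a) t) p * ennreal (t powr \<alpha>) * indicator {0<..} t"
      by (auto simp: indicator_def)
  qed
  finally have "epowr (ennreal (1 / a powr p * (1 / r))) (1 / p) \<le> Cop_norm p \<alpha> (power_tail a)"
    unfolding Cop_norm_eq using p by (intro epowr_mono) auto
  also have "epowr (ennreal (1 / a powr p * (1 / r))) (1 / p) = ennreal ((1 / a powr p * (1 / r)) powr (1 / p))"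
    using r by (intro epowr_ennreal) simp
  also have "(1 / a powr p * (1 / r)) powr (1 / p) = l / a"
    using r a0 p by (simp add: l_def r_def powr_mult powr_divide powr_powr)
  finally show "ennreal (l / a) \<le> Cop_norm p \<alpha> (power_tail a)" .
qed

text \<open>
  The factorization \<open>h = h \<cdot> 1\<close> of a power tail bounds \<open>N\<^sup>*\<close> by the \<open>L\<^sup>p\<close> norm, which is
  at most \<open>a\<close> times the Copson norm; letting \<open>a\<close> decrease to \<open>\<delta>\<close> gives \<open>1 / \<delta> = p / (\<alpha> + 1)\<close>.
\<close>

lemma upper_constant_optimal:
  fixes c :: real
  assumes "\<And>h. h \<in> Cop p \<alpha> \<Longrightarrow> Cop_norm p \<alpha> h \<le> ennreal c * Nstar p q \<alpha> h"
  shows "p / (\<alpha> + 1) \<le> c"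
proof -
  have bound: "1 / a \<le> c" if a: "\<delta> < a" for a
  proof -
    let ?h = "power_tail a"
    define l where "l = (1 / (p * (a - \<delta>))) powr (1 / p)"
    have l: "0 < l"
      using a p by (simp add: l_def)
    note norms = power_tail_norms[OF a, folded l_def]
    have meas: "?h \<in> borel_measurable halfline"
      unfolding power_tail_def by (rule borel_measurable_lebesgue_on) measurable
    have "Gstar_norm q (\<alpha> * (1 - q)) (\<lambda>_. 1) < \<infinity>"
      using Gstar_norm_one_le by (rule le_less_trans) simp
    then have fact: "is_factorization p q \<alpha> ?h ?h (\<lambda>_. 1)"
      using meas norms(1) by (simp add: is_factorization_def Lp_def Gstar_def)
    then have "?h \<in> Cop p \<alpha>"
      using meas Cop_iff_factorization by blast
    have "ennreal (l / a) \<le> Cop_norm p \<alpha> ?h"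
      by (rule norms)
    also have "\<dots> \<le> ennreal c * Nstar p q \<alpha> ?h"
      by (rule assms) fact
    also have "Nstar p q \<alpha> ?h \<le> Lp_norm p \<alpha> ?h * Gstar_norm q (\<alpha> * (1 - q)) (\<lambda>_. 1)"
      unfolding Nstar_def by (rule INF_lower2[of "(?h, \<lambda>_. 1)"]) (use fact in auto)
    also have "\<dots> \<le> Lp_norm p \<alpha> ?h * 1"
      by (intro mult_left_mono Gstar_norm_one_le) simp
    finally have le: "ennreal (l / a) \<le> ennreal c * ennreal l"
      by (simp add: norms(1) mult_left_mono)
    have la: "0 < l / a"
      using l a \<delta>_pos by simp
    have "0 < c"
      using le la by (cases "0 < c") (auto simp: ennreal_neg)
    then have "l / a \<le> c * l"
      using le l by (simp flip: ennreal_mult)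
    then show ?thesis
      using l a \<delta>_pos by (simp add: field_simps)
  qed
  have "((\<lambda>a. 1 / a) \<longlongrightarrow> 1 / \<delta>) (at_right \<delta>)"
    using \<delta>_pos by (intro tendsto_intros) auto
  moreover have "\<forall>\<^sub>F a in at_right \<delta>. 1 / a \<le> c"
    using bound by (auto simp: eventually_at_right_field intro: exI[of _ "\<delta> + 1"])
  ultimately have "1 / \<delta> \<le> c"
    by (rule tendsto_upperbound) simp
  then show ?thesis
    by (simp add: \<delta>_def)
qed

end

section \<open>The factorization theorem\<close>

theorem corollary4p2:
  fixes p p' \<alpha> :: real
  assumes "p > 1" and "p' = p / (p - 1)" and "\<alpha> > - 1"
  shows "(\<forall>h \<in> borel_measurable halfline.
            h \<in> Cop p \<alpha> \<longleftrightarrow> (\<exists>f g. is_factorization p p' \<alpha> h f g)) \<and>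
         (\<forall>h \<in> Cop p \<alpha>.
            ennreal ((p - 1) powr (1 / p') / (\<alpha> + 1)) * Nstar p p' \<alpha> h \<le> Cop_norm p \<alpha> h \<and>
            Cop_norm p \<alpha> h \<le> ennreal (p / (\<alpha> + 1)) * Nstar p p' \<alpha> h) \<and>
         (\<forall>c::real. (\<forall>h \<in> Cop p \<alpha>. ennreal c * Nstar p p' \<alpha> h \<le> Cop_norm p \<alpha> h) \<longrightarrow>
            c \<le> (p - 1) powr (1 / p') / (\<alpha> + 1)) \<and>
         (\<forall>c::real. (\<forall>h \<in> Cop p \<alpha>. Cop_norm p \<alpha> h \<le> ennreal c * Nstar p p' \<alpha> h) \<longrightarrow>
            p / (\<alpha> + 1) \<le> c)"
proof -
  interpret copson_exponents p p' \<alpha>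
    using assms by unfold_locales
  show ?thesis
    using Cop_iff_factorization Nstar_le_Cop_norm Cop_norm_le_Nstar
      lower_constant_optimal upper_constant_optimal by blast
qed

end
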